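(* Let $p$ be a prime, $s$ a positive integer, and $(C_p)^s=\langle\sigma_1\rangle\times\cdots\times\langle\sigma_s\rangle$ a direct product of $s$ cyclic groups of order $p$, acting trivially on $\mathbb{C}$. For $0\le i\le\lfloor\frac s2\rfloor$ let $\alpha_i$ be the alternating bicharacter on $(C_p)^s$ determined by its values for $j<l$: $\alpha_i(\sigma_j,\sigma_l)=\exp(\frac{2\pi \sqrt{-1}}{p})$ if $1\le j\le i$ and $l=j+i$, and $\alpha_i(\sigma_j,\sigma_l)=1$ otherwise. Then $\{\alpha_i\}_{i=0}^{\lfloor s/2\rfloor}$ is a complete set of representatives for the Hamming isometry classes of the complex twisted group algebras of $(C_p)^s$. That is, if for each $i$ a cocycle $f_i\in Z^2((C_p)^s,\mathbb{C}^* )$ with $\alpha_{f_i}=\alpha_i$ is chosen (such cocycles exist), then for every $f\in Z^2((C_p)^s,\mathbb{C}^* )$ the algebra $\mathbb{C}^f*(C_p)^s$ is isometric to $\mathbb{C}^{f_i}*(C_p)^s$ for exactly one $i\in\{0,\dots,\lfloor\frac s2\rfloor\}$.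
   Context: For a finite group $G$ acting trivially on $\mathbb{C}$, $Z^2(G,\mathbb{C}^* )$ is the group of 2-cocycles $f:G\times G\to\mathbb{C}^*$, i.e. $f(g,h)f(gh,k)=f(h,k)f(g,hk)$. The twisted group algebra $\mathbb{C}^f*G$ is the associative $\mathbb{C}$-algebra with basis $\{u_g\}_{g\in G}$ and multiplication $u_gu_h=f(g,h)u_{gh}$. The Hamming weight of $\sum_g\beta_gu_g$ is the number of $g$ with $\beta_g\neq0$; an isometry between two twisted group algebras is a bijective $\mathbb{C}$-linear ring homomorphism preserving Hamming weights, and two such algebras are isometric (in the same Hamming isometry class) if an isometry between them exists. An alternating bicharacter on $(C_p)^s$ is a function $\alpha:(C_p)^s\times(C_p)^s\to\mathbb{C}^*$ that is a group homomorphism in each argument with the other fixed and satisfies $\alpha(g,g)=1$ for all $g$ (hence $\alpha(g,h)=\alpha(h,g)^{-1}$). For $f\in Z^2((C_p)^s,\mathbb{C}^* )$, $\alpha_f(g,h):=f(g,h)f(h,g)^{-1}$; this is an alternating bicharacter. *)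

theory Defs
  imports Complex_Main "HOL-Algebra.Algebra" "HOL-Algebra.Product_Groups"
    "HOL-Algebra.Algebraic_Closure_Type"
begin

abbreviation complex_ring :: "complex ring"
  where "complex_ring \<equiv> ring_of_type_algebra"

text \<open>
  Functions on a carrier are taken in extensional form (value \<open>undefined\<close> off the
  carrier), so that equality of functions on the carrier is HOL equality. Functions of two
  group elements take pairs.
\<close>

definition cocycles2 :: "('a, 'm) monoid_scheme \<Rightarrow> ('a \<times> 'a \<Rightarrow> complex) set" where
  "cocycles2 G = {f \<in> carrier G \<times> carrier G \<rightarrow>\<^sub>E carrier (mult_of complex_ring).
     \<forall>g\<in>carrier G. \<forall>h\<in>carrier G. \<forall>k\<in>carrier G.
       f (g, h) * f (g \<otimes>\<^bsub>G\<^esub> h, k) = f (h, k) * f (g, h \<otimes>\<^bsub>G\<^esub> k)}"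

definition alternating_bicharacters :: "('a, 'm) monoid_scheme \<Rightarrow> ('a \<times> 'a \<Rightarrow> complex) set" where
  "alternating_bicharacters G = {\<alpha> \<in> extensional (carrier G \<times> carrier G).
     (\<forall>h\<in>carrier G. (\<lambda>g. \<alpha> (g, h)) \<in> hom G (mult_of complex_ring)) \<and>
     (\<forall>g\<in>carrier G. (\<lambda>h. \<alpha> (g, h)) \<in> hom G (mult_of complex_ring)) \<and>
     (\<forall>g\<in>carrier G. \<alpha> (g, g) = 1)}"

definition cocycle_bicharacter ::
    "('a, 'm) monoid_scheme \<Rightarrow> ('a \<times> 'a \<Rightarrow> complex) \<Rightarrow> 'a \<times> 'a \<Rightarrow> complex" where
  "cocycle_bicharacter G f = (\<lambda>(g, h)\<in>carrier G \<times> carrier G. f (g, h) * inverse (f (h, g)))"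

text \<open>
  An element \<open>\<Sum>\<^sub>g \<beta>\<^sub>g u\<^sub>g\<close> of the twisted group algebra of a finite group is its coefficient
  function \<open>\<beta>\<close>. Cocycles are not assumed normalized, so the unit is \<open>f(1,1)\<^sup>-\<^sup>1 u\<^sub>1\<close>.
\<close>

definition twisted_group_algebra ::
    "('a, 'm) monoid_scheme \<Rightarrow> ('a \<times> 'a \<Rightarrow> complex) \<Rightarrow> (complex, 'a \<Rightarrow> complex) module" where
  "twisted_group_algebra G f =
    \<lparr>carrier = carrier G \<rightarrow>\<^sub>E UNIV,
     monoid.mult = (\<lambda>x y. \<lambda>k\<in>carrier G.
       \<Sum>(g, h)\<in>{(g, h) \<in> carrier G \<times> carrier G. g \<otimes>\<^bsub>G\<^esub> h = k}. x g * y h * f (g, h)),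
     one = (\<lambda>k\<in>carrier G. if k = \<one>\<^bsub>G\<^esub> then inverse (f (\<one>\<^bsub>G\<^esub>, \<one>\<^bsub>G\<^esub>)) else 0),
     ring.zero = (\<lambda>k\<in>carrier G. 0),
     add = (\<lambda>x y. \<lambda>k\<in>carrier G. x k + y k),
     module.smult = (\<lambda>c x. \<lambda>k\<in>carrier G. c * x k)\<rparr>"

definition basis_elt :: "('a, 'm) monoid_scheme \<Rightarrow> 'a \<Rightarrow> 'a \<Rightarrow> complex" where
  "basis_elt G g = (\<lambda>k\<in>carrier G. if k = g then 1 else 0)"

definition hamming_weight :: "('a, 'm) monoid_scheme \<Rightarrow> ('a \<Rightarrow> complex) \<Rightarrow> nat" where
  "hamming_weight G x = card {g \<in> carrier G. x g \<noteq> 0}"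

definition isometries ::
    "('a, 'm) monoid_scheme \<Rightarrow> ('a \<times> 'a \<Rightarrow> complex) \<Rightarrow>
     ('b, 'n) monoid_scheme \<Rightarrow> ('b \<times> 'b \<Rightarrow> complex) \<Rightarrow> (('a \<Rightarrow> complex) \<Rightarrow> 'b \<Rightarrow> complex) set" where
  "isometries G f H f' =
    {\<phi> \<in> ring_hom (twisted_group_algebra G f) (twisted_group_algebra H f').
       bij_betw \<phi> (carrier (twisted_group_algebra G f)) (carrier (twisted_group_algebra H f')) \<and>
       (\<forall>c. \<forall>x\<in>carrier (twisted_group_algebra G f).
          \<phi> (c \<odot>\<^bsub>twisted_group_algebra G f\<^esub> x) = c \<odot>\<^bsub>twisted_group_algebra H f'\<^esub> \<phi> x) \<and>
       (\<forall>x\<in>carrier (twisted_group_algebra G f). hamming_weight H (\<phi> x) = hamming_weight G x)}"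

definition isometric ::
    "('a, 'm) monoid_scheme \<Rightarrow> ('a \<times> 'a \<Rightarrow> complex) \<Rightarrow>
     ('b, 'n) monoid_scheme \<Rightarrow> ('b \<times> 'b \<Rightarrow> complex) \<Rightarrow> bool" where
  "isometric G f H f' \<longleftrightarrow> isometries G f H f' \<noteq> {}"

text \<open>
  \<open>G = \<langle>\<sigma>\<^sub>1\<rangle> \<times> \<dots> \<times> \<langle>\<sigma>\<^sub>s\<rangle>\<close> as an internal direct product of cyclic groups of order \<open>p\<close>.
\<close>

definition direct_product_cyclic ::
    "('a, 'm) monoid_scheme \<Rightarrow> nat \<Rightarrow> nat \<Rightarrow> (nat \<Rightarrow> 'a) \<Rightarrow> bool" where
  "direct_product_cyclic G p s \<sigma> \<longleftrightarrow>
     comm_group G \<and>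
     (\<forall>j\<in>{1..s}. \<sigma> j \<in> carrier G \<and> Coset.order (subgroup_generated G {\<sigma> j}) = p) \<and>
     (\<lambda>x. finprod G x {1..s})
       \<in> iso (product_group {1..s} (\<lambda>j. subgroup_generated G {\<sigma> j})) G"

definition alpha_values :: "nat \<Rightarrow> nat \<Rightarrow> (nat \<Rightarrow> 'a) \<Rightarrow> nat \<Rightarrow> ('a \<times> 'a \<Rightarrow> complex) \<Rightarrow> bool" where
  "alpha_values p s \<sigma> i \<alpha> \<longleftrightarrow>
     (\<forall>j\<in>{1..s}. \<forall>l\<in>{1..s}. j < l \<longrightarrow>
        \<alpha> (\<sigma> j, \<sigma> l) =
          (if 1 \<le> j \<and> j \<le> i \<and> l = j + i then exp (2 * complex_of_real pi * \<i> / of_nat p) else 1))"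

definition alpha ::
    "('a, 'm) monoid_scheme \<Rightarrow> nat \<Rightarrow> nat \<Rightarrow> (nat \<Rightarrow> 'a) \<Rightarrow> nat \<Rightarrow> 'a \<times> 'a \<Rightarrow> complex" where
  "alpha G p s \<sigma> i = (THE \<alpha>. \<alpha> \<in> alternating_bicharacters G \<and> alpha_values p s \<sigma> i \<alpha>)"

text \<open>The twisted group algebra is an associative algebra with \<open>u\<^sub>g u\<^sub>h = f(g,h) u\<^sub>g\<^sub>h\<close>.\<close>

lemma cring_complex_ring: "cring complex_ring"
proof (rule cringI)
  have "\<exists>y. y + x = 0" for x :: complex
    by (rule exI[of _ "- x"]) simp
  then show "abelian_group complex_ring"
    by (intro abelian_groupI) (auto simp: ring_of_type_algebra_def)
qed (auto intro!: comm_monoidI simp: ring_of_type_algebra_def algebra_simps)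

lemma tga_simps:
  "carrier (twisted_group_algebra G f) = carrier G \<rightarrow>\<^sub>E UNIV"
  "x \<oplus>\<^bsub>twisted_group_algebra G f\<^esub> y = (\<lambda>k\<in>carrier G. x k + y k)"
  "\<zero>\<^bsub>twisted_group_algebra G f\<^esub> = (\<lambda>k\<in>carrier G. 0)"
  "c \<odot>\<^bsub>twisted_group_algebra G f\<^esub> x = (\<lambda>k\<in>carrier G. c * x k)"
  by (simp_all add: twisted_group_algebra_def)

lemma tga_one:
  "\<one>\<^bsub>twisted_group_algebra G f\<^esub>
    = (\<lambda>k\<in>carrier G. if k = \<one>\<^bsub>G\<^esub> then inverse (f (\<one>\<^bsub>G\<^esub>, \<one>\<^bsub>G\<^esub>)) else 0)"
  by (simp add: twisted_group_algebra_def)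

lemma tga_mult:
  assumes "finite (carrier G)"
  shows "x \<otimes>\<^bsub>twisted_group_algebra G f\<^esub> y = (\<lambda>k\<in>carrier G.
     \<Sum>g\<in>carrier G. \<Sum>h\<in>carrier G. if g \<otimes>\<^bsub>G\<^esub> h = k then x g * y h * f (g, h) else 0)"
proof -
  have "(\<Sum>(g, h)\<in>{(g, h) \<in> carrier G \<times> carrier G. g \<otimes>\<^bsub>G\<^esub> h = k}. x g * y h * f (g, h))
     = (\<Sum>g\<in>carrier G. \<Sum>h\<in>carrier G. if g \<otimes>\<^bsub>G\<^esub> h = k then x g * y h * f (g, h) else 0)" for k
  proof -
    have "(\<Sum>g\<in>carrier G. \<Sum>h\<in>carrier G. if g \<otimes>\<^bsub>G\<^esub> h = k then x g * y h * f (g, h) else 0)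
        = (\<Sum>z\<in>carrier G \<times> carrier G.
             if fst z \<otimes>\<^bsub>G\<^esub> snd z = k then x (fst z) * y (snd z) * f z else 0)"
      by (simp add: sum.cartesian_product case_prod_unfold cong: if_cong)
    also have "\<dots> = (\<Sum>z\<in>{z \<in> carrier G \<times> carrier G. fst z \<otimes>\<^bsub>G\<^esub> snd z = k}.
             x (fst z) * y (snd z) * f z)"
      using assms by (simp add: sum.inter_filter)
    finally show ?thesis
      by (simp add: case_prod_unfold mem_Times_iff)
  qed
  then show ?thesis
    by (simp add: twisted_group_algebra_def)
qed

lemma basis_elt_mult:
  assumes "group G" "finite (carrier G)" "g \<in> carrier G" "h \<in> carrier G"
  shows "basis_elt G g \<otimes>\<^bsub>twisted_group_algebra G f\<^esub> basis_elt G h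
       = f (g, h) \<odot>\<^bsub>twisted_group_algebra G f\<^esub> basis_elt G (g \<otimes>\<^bsub>G\<^esub> h)"
proof -
  have "(\<Sum>a\<in>carrier G. \<Sum>b\<in>carrier G. if a \<otimes>\<^bsub>G\<^esub> b = k
          then basis_elt G g a * basis_elt G h b * f (a, b) else 0)
      = (if g \<otimes>\<^bsub>G\<^esub> h = k then f (g, h) else 0)" for k
  proof -
    have "(\<Sum>a\<in>carrier G. \<Sum>b\<in>carrier G. if a \<otimes>\<^bsub>G\<^esub> b = k
            then basis_elt G g a * basis_elt G h b * f (a, b) else 0)
        = (\<Sum>a\<in>carrier G. if a = g then
             (\<Sum>b\<in>carrier G. if b = h then (if g \<otimes>\<^bsub>G\<^esub> h = k then f (g, h) else 0) else 0) else 0)"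
      by (intro sum.cong refl) (auto simp: basis_elt_def intro!: sum.cong sum.neutral)
    then show ?thesis
      using assms by simp
  qed
  then show ?thesis
    using assms(2) group.is_monoid[OF assms(1)]
    by (simp only: tga_mult) (auto simp: tga_simps basis_elt_def fun_eq_iff restrict_def)
qed

lemma sum_if_eq_mid:
  assumes "finite A" "c \<in> A"
  shows "(\<Sum>a\<in>A. if c = a then F a else 0) = (F c :: complex)"
  using assms by simp

lemma tga_mult_assoc:
  assumes "group G" "finite (carrier G)" "f \<in> cocycles2 G"
  shows "(x \<otimes>\<^bsub>twisted_group_algebra G f\<^esub> y) \<otimes>\<^bsub>twisted_group_algebra G f\<^esub> z
       = x \<otimes>\<^bsub>twisted_group_algebra G f\<^esub> (y \<otimes>\<^bsub>twisted_group_algebra G f\<^esub> z)"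
    (is "?L = ?R")
proof
  fix m
  interpret group G by fact
  let ?C = "carrier G"
  show "?L m = ?R m"
  proof (cases "m \<in> ?C")
    case True
    have "?L m = (\<Sum>a\<in>?C. \<Sum>b\<in>?C. \<Sum>g\<in>?C. \<Sum>h\<in>?C.
        if g \<otimes>\<^bsub>G\<^esub> h = a then (if a \<otimes>\<^bsub>G\<^esub> b = m then x g * y h * f (g, h) * z b * f (a, b) else 0) else 0)"
      using True assms(2)
      by (auto simp: tga_mult sum_distrib_right sum_distrib_left intro!: sum.cong sum.neutral)
    also have "\<dots> = (\<Sum>a\<in>?C. \<Sum>g\<in>?C. \<Sum>b\<in>?C. \<Sum>h\<in>?C.
        if g \<otimes>\<^bsub>G\<^esub> h = a then (if a \<otimes>\<^bsub>G\<^esub> b = m then x g * y h * f (g, h) * z b * f (a, b) else 0) else 0)"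
      by (intro sum.cong refl sum.swap)
    also have "\<dots> = (\<Sum>g\<in>?C. \<Sum>a\<in>?C. \<Sum>h\<in>?C. \<Sum>b\<in>?C.
        if g \<otimes>\<^bsub>G\<^esub> h = a then (if a \<otimes>\<^bsub>G\<^esub> b = m then x g * y h * f (g, h) * z b * f (a, b) else 0) else 0)"
      by (subst sum.swap) (intro sum.cong refl sum.swap)
    also have "\<dots> = (\<Sum>g\<in>?C. \<Sum>h\<in>?C. \<Sum>a\<in>?C. \<Sum>b\<in>?C.
        if g \<otimes>\<^bsub>G\<^esub> h = a then (if a \<otimes>\<^bsub>G\<^esub> b = m then x g * y h * f (g, h) * z b * f (a, b) else 0) else 0)"
      by (intro sum.cong refl sum.swap)
    also have "\<dots> = (\<Sum>g\<in>?C. \<Sum>h\<in>?C. \<Sum>b\<in>?C. \<Sum>a\<in>?C.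
        if g \<otimes>\<^bsub>G\<^esub> h = a then (if a \<otimes>\<^bsub>G\<^esub> b = m then x g * y h * f (g, h) * z b * f (a, b) else 0) else 0)"
      by (intro sum.cong refl sum.swap)
    also have "\<dots> = (\<Sum>g\<in>?C. \<Sum>h\<in>?C. \<Sum>b\<in>?C.
        if g \<otimes>\<^bsub>G\<^esub> h \<otimes>\<^bsub>G\<^esub> b = m then x g * y h * f (g, h) * z b * f (g \<otimes>\<^bsub>G\<^esub> h, b) else 0)"
      using assms(2) by (intro sum.cong refl sum_if_eq_mid) auto
    also have "\<dots> = (\<Sum>g\<in>?C. \<Sum>h\<in>?C. \<Sum>b\<in>?C.
        if g \<otimes>\<^bsub>G\<^esub> (h \<otimes>\<^bsub>G\<^esub> b) = m then x g * (y h * z b * f (h, b)) * f (g, h \<otimes>\<^bsub>G\<^esub> b) else 0)"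
    proof (intro sum.cong refl)
      fix g h b assume "g \<in> ?C" "h \<in> ?C" "b \<in> ?C"
      moreover from this have "f (g, h) * f (g \<otimes>\<^bsub>G\<^esub> h, b) = f (h, b) * f (g, h \<otimes>\<^bsub>G\<^esub> b)"
        using assms(3) by (auto simp: cocycles2_def)
      then have "x g * y h * z b * (f (g, h) * f (g \<otimes>\<^bsub>G\<^esub> h, b))
               = x g * y h * z b * (f (h, b) * f (g, h \<otimes>\<^bsub>G\<^esub> b))"
        by simp
      ultimately show "(if g \<otimes>\<^bsub>G\<^esub> h \<otimes>\<^bsub>G\<^esub> b = m
            then x g * y h * f (g, h) * z b * f (g \<otimes>\<^bsub>G\<^esub> h, b) else 0)
          = (if g \<otimes>\<^bsub>G\<^esub> (h \<otimes>\<^bsub>G\<^esub> b) = m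
            then x g * (y h * z b * f (h, b)) * f (g, h \<otimes>\<^bsub>G\<^esub> b) else 0)"
        by (simp add: m_assoc ac_simps)
    qed
    also have "\<dots> = (\<Sum>g\<in>?C. \<Sum>h\<in>?C. \<Sum>b\<in>?C. \<Sum>a\<in>?C.
        if h \<otimes>\<^bsub>G\<^esub> b = a then (if g \<otimes>\<^bsub>G\<^esub> a = m then x g * (y h * z b * f (h, b)) * f (g, a) else 0) else 0)"
      using assms(2) by (intro sum.cong refl sum_if_eq_mid[symmetric]) auto
    also have "\<dots> = (\<Sum>g\<in>?C. \<Sum>h\<in>?C. \<Sum>a\<in>?C. \<Sum>b\<in>?C.
        if h \<otimes>\<^bsub>G\<^esub> b = a then (if g \<otimes>\<^bsub>G\<^esub> a = m then x g * (y h * z b * f (h, b)) * f (g, a) else 0) else 0)"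
      by (intro sum.cong refl sum.swap)
    also have "\<dots> = (\<Sum>g\<in>?C. \<Sum>a\<in>?C. \<Sum>h\<in>?C. \<Sum>b\<in>?C.
        if h \<otimes>\<^bsub>G\<^esub> b = a then (if g \<otimes>\<^bsub>G\<^esub> a = m then x g * (y h * z b * f (h, b)) * f (g, a) else 0) else 0)"
      by (intro sum.cong refl sum.swap)
    also have "\<dots> = ?R m"
      using True assms(2)
      by (auto simp: tga_mult sum_distrib_right sum_distrib_left intro!: sum.cong sum.neutral)
    finally show ?thesis .
  qed (simp add: tga_mult assms(2))
qed

lemma cocycle_one:
  assumes "group G" "f \<in> cocycles2 G" "g \<in> carrier G"
  shows "f (\<one>\<^bsub>G\<^esub>, g) = f (\<one>\<^bsub>G\<^esub>, \<one>\<^bsub>G\<^esub>)" "f (g, \<one>\<^bsub>G\<^esub>) = f (\<one>\<^bsub>G\<^esub>, \<one>\<^bsub>G\<^esub>)"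
    "f (\<one>\<^bsub>G\<^esub>, \<one>\<^bsub>G\<^esub>) \<noteq> 0"
proof -
  interpret group G by fact
  have nz: "f (a, b) \<noteq> 0" if "a \<in> carrier G" "b \<in> carrier G" for a b
    using assms(2) that by (auto simp: cocycles2_def ring_of_type_algebra_def PiE_iff)
  have coc: "f (a, b) * f (a \<otimes>\<^bsub>G\<^esub> b, c) = f (b, c) * f (a, b \<otimes>\<^bsub>G\<^esub> c)"
    if "a \<in> carrier G" "b \<in> carrier G" "c \<in> carrier G" for a b c
    using assms(2) that by (auto simp: cocycles2_def)
  show "f (\<one>\<^bsub>G\<^esub>, g) = f (\<one>\<^bsub>G\<^esub>, \<one>\<^bsub>G\<^esub>)"
    using coc[of "\<one>\<^bsub>G\<^esub>" "\<one>\<^bsub>G\<^esub>" g] nz assms(3) by simp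
  show "f (g, \<one>\<^bsub>G\<^esub>) = f (\<one>\<^bsub>G\<^esub>, \<one>\<^bsub>G\<^esub>)"
    using coc[of g "\<one>\<^bsub>G\<^esub>" "\<one>\<^bsub>G\<^esub>"] nz assms(3) by simp
  show "f (\<one>\<^bsub>G\<^esub>, \<one>\<^bsub>G\<^esub>) \<noteq> 0"
    using nz by simp
qed

lemma tga_one_mult:
  assumes "group G" "finite (carrier G)" "f \<in> cocycles2 G" "x \<in> carrier G \<rightarrow>\<^sub>E UNIV"
  shows "\<one>\<^bsub>twisted_group_algebra G f\<^esub> \<otimes>\<^bsub>twisted_group_algebra G f\<^esub> x = x"
    and "x \<otimes>\<^bsub>twisted_group_algebra G f\<^esub> \<one>\<^bsub>twisted_group_algebra G f\<^esub> = x"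
proof -
  interpret group G by fact
  let ?c = "f (\<one>\<^bsub>G\<^esub>, \<one>\<^bsub>G\<^esub>)" and ?e = "\<one>\<^bsub>twisted_group_algebra G f\<^esub>"
  have e: "?e k = (if k = \<one>\<^bsub>G\<^esub> then inverse ?c else 0)" if "k \<in> carrier G" for k
    using that by (simp add: tga_one)
  have c1: "inverse ?c * a * f (\<one>\<^bsub>G\<^esub>, h) = a" if "h \<in> carrier G" for a h
    unfolding cocycle_one(1)[OF assms(1,3) that] using cocycle_one(3)[OF assms(1,3) that] by simp
  have c2: "a * inverse ?c * f (h, \<one>\<^bsub>G\<^esub>) = a" if "h \<in> carrier G" for a h
    unfolding cocycle_one(2)[OF assms(1,3) that] using cocycle_one(3)[OF assms(1,3) that] by simp
  have "(\<Sum>g\<in>carrier G. \<Sum>h\<in>carrier G. if g \<otimes>\<^bsub>G\<^esub> h = k then ?e g * x h * f (g, h) else 0) = x k"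
    if k: "k \<in> carrier G" for k
  proof -
    have "(\<Sum>g\<in>carrier G. \<Sum>h\<in>carrier G. if g \<otimes>\<^bsub>G\<^esub> h = k then ?e g * x h * f (g, h) else 0)
        = (\<Sum>g\<in>carrier G. if g = \<one>\<^bsub>G\<^esub> then (\<Sum>h\<in>carrier G. if h = k then x k else 0) else 0)"
      by (intro sum.cong refl) (auto simp: e c1 c1[of _ 1, simplified] intro!: sum.cong sum.neutral)
    then show ?thesis
      using assms(2) k by simp
  qed
  then show "?e \<otimes>\<^bsub>twisted_group_algebra G f\<^esub> x = x"
    unfolding tga_mult[OF assms(2)] using assms(4)
    by (intro ext) (auto simp: restrict_def PiE_iff extensional_def)
  have "(\<Sum>g\<in>carrier G. \<Sum>h\<in>carrier G. if g \<otimes>\<^bsub>G\<^esub> h = k then x g * ?e h * f (g, h) else 0) = x k"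
    if k: "k \<in> carrier G" for k
  proof -
    have "(\<Sum>g\<in>carrier G. \<Sum>h\<in>carrier G. if g \<otimes>\<^bsub>G\<^esub> h = k then x g * ?e h * f (g, h) else 0)
        = (\<Sum>g\<in>carrier G. \<Sum>h\<in>carrier G. if h = \<one>\<^bsub>G\<^esub> then (if g = k then x k else 0) else 0)"
      by (intro sum.cong refl) (auto simp: e c2 c2[of _ 1, simplified])
    then show ?thesis
      using assms(2) k by simp
  qed
  then show "x \<otimes>\<^bsub>twisted_group_algebra G f\<^esub> ?e = x"
    unfolding tga_mult[OF assms(2)] using assms(4)
    by (intro ext) (auto simp: restrict_def PiE_iff extensional_def)
qed

lemma module_twisted_group_algebra: "module complex_ring (twisted_group_algebra G f)"
proof (rule moduleI[OF cring_complex_ring])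
  show "abelian_group (twisted_group_algebra G f)"
  proof (rule abelian_groupI)
    fix x assume "x \<in> carrier (twisted_group_algebra G f)"
    show "\<exists>y\<in>carrier (twisted_group_algebra G f).
        y \<oplus>\<^bsub>twisted_group_algebra G f\<^esub> x = \<zero>\<^bsub>twisted_group_algebra G f\<^esub>"
      by (rule bexI[of _ "\<lambda>k\<in>carrier G. - x k"]) (auto simp: tga_simps)
  qed (auto simp: tga_simps restrict_def PiE_iff extensional_def fun_eq_iff)
qed (auto simp: tga_simps ring_of_type_algebra_def restrict_def PiE_iff extensional_def
       fun_eq_iff distrib_left distrib_right)

lemma ring_twisted_group_algebra:
  assumes "group G" "finite (carrier G)" "f \<in> cocycles2 G"
  shows "ring (twisted_group_algebra G f)"
proof (rule ringI)
  show "abelian_group (twisted_group_algebra G f)"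
    using module_twisted_group_algebra by (auto simp: module_def)
  show "Group.monoid (twisted_group_algebra G f)"
    using assms tga_one_mult[OF assms] tga_mult_assoc[OF assms]
    by (intro monoidI) (auto simp: tga_simps(1) tga_mult tga_one)
next
  fix x y z
  show "(x \<oplus>\<^bsub>twisted_group_algebra G f\<^esub> y) \<otimes>\<^bsub>twisted_group_algebra G f\<^esub> z
      = x \<otimes>\<^bsub>twisted_group_algebra G f\<^esub> z \<oplus>\<^bsub>twisted_group_algebra G f\<^esub> y \<otimes>\<^bsub>twisted_group_algebra G f\<^esub> z"
    unfolding tga_simps(2) tga_mult[OF assms(2)]
    by (rule restrict_ext) (auto simp: distrib_right simp flip: sum.distrib intro!: sum.cong)
  show "z \<otimes>\<^bsub>twisted_group_algebra G f\<^esub> (x \<oplus>\<^bsub>twisted_group_algebra G f\<^esub> y)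
      = z \<otimes>\<^bsub>twisted_group_algebra G f\<^esub> x \<oplus>\<^bsub>twisted_group_algebra G f\<^esub> z \<otimes>\<^bsub>twisted_group_algebra G f\<^esub> y"
    unfolding tga_simps(2) tga_mult[OF assms(2)]
    by (rule restrict_ext) (auto simp: distrib_right distrib_left simp flip: sum.distrib intro!: sum.cong)
qed

lemma tga_smult_mult:
  assumes "finite (carrier G)"
  shows "(c \<odot>\<^bsub>twisted_group_algebra G f\<^esub> x) \<otimes>\<^bsub>twisted_group_algebra G f\<^esub> y
       = c \<odot>\<^bsub>twisted_group_algebra G f\<^esub> (x \<otimes>\<^bsub>twisted_group_algebra G f\<^esub> y)"
    and "x \<otimes>\<^bsub>twisted_group_algebra G f\<^esub> (c \<odot>\<^bsub>twisted_group_algebra G f\<^esub> y)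
       = c \<odot>\<^bsub>twisted_group_algebra G f\<^esub> (x \<otimes>\<^bsub>twisted_group_algebra G f\<^esub> y)"
  unfolding tga_simps(4) tga_mult[OF assms]
  by (rule restrict_ext; auto simp: sum_distrib_left intro!: sum.cong)+

end

theory Submission
  imports Defs
begin

text \<open>
  An isometry sends each \<open>u\<^sub>g\<close> to a scalar multiple of some \<open>u\<^bsub>\<psi>(g)\<^esub>\<close>, and multiplicativity says that
  \<open>\<psi>\<close> is an automorphism of the group carrying \<open>f\<close> to \<open>f'\<close> up to a coboundary. Symmetric cocycles
  of an elementary abelian group are coboundaries, so the isometry classes are the orbits of the
  alternating bicharacters under automorphisms. Splitting off hyperbolic pairs brings a bicharacter
  into the form \<open>\<alpha>\<^sub>i\<close>, and \<open>i\<close> is determined by the size of the radical.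
\<close>

subsection \<open>Bicharacters and complex roots of unity\<close>

text \<open>Since the group is abelian, the scalars of a coboundary cancel in
  \<open>f (g, h) / f (h, g)\<close>. Conversely, two cocycles with the same bicharacter have a
  symmetric quotient, and a symmetric cocycle defines an abelian extension by the divisible group of
  nonzero complex numbers, which splits. This is why only the bicharacter matters for isometry. The
  group is given as an internal direct product, so linear algebra over the field with
  \<open>p\<close> elements is expressed through generators and exponents: coordinates are natural
  numbers that have a meaning only modulo \<open>p\<close>, and a homomorphism is built from the
  images of the generators, which must have trivial \<open>p\<close>-th power. The same construction
  yields the automorphisms of the group and the section of the extension. The order of a radical is
  never computed. The radicals of the \<alpha>\<open>\<^sub>i\<close> form a strictly decreasing
  chain of finite sets, which already makes their cardinalities distinct.\<close>

abbreviation (input) cplx_mult :: "complex monoid"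
  where "cplx_mult \<equiv> mult_of complex_ring"

lemma complex_ring_simps [simp]:
  "carrier complex_ring = UNIV" "x \<otimes>\<^bsub>complex_ring\<^esub> y = x * y"
  "\<one>\<^bsub>complex_ring\<^esub> = 1" "\<zero>\<^bsub>complex_ring\<^esub> = 0"
  by (auto simp: ring_of_type_algebra_def)

lemma comm_group_cplx_mult: "comm_group cplx_mult"
proof (rule comm_groupI)
  fix x assume "x \<in> carrier cplx_mult"
  then show "\<exists>y\<in>carrier cplx_mult. y \<otimes>\<^bsub>cplx_mult\<^esub> x = \<one>\<^bsub>cplx_mult\<^esub>"
    by (intro bexI[of _ "inverse x"]) auto
qed (auto simp: ac_simps)

definition prim_root :: "nat \<Rightarrow> complex"
  where "prim_root p = exp (2 * complex_of_real pi * \<i> / of_nat p)"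

text \<open>Brings powers into the shape used by \<open>bij_betw_roots_unity\<close>. Its
  injectivity gives the exact order of the root, its surjectivity presents every \<open>p\<close>-th
  root of unity as a power.\<close>

lemma prim_root_pow: "prim_root p ^ k = cis (2 * pi * real k / real p)"
  by (simp add: prim_root_def cis_conv_exp flip: exp_of_nat_mult) (simp add: mult_ac)

context
  fixes p :: nat
  assumes p: "p > 0"
begin

lemma prim_root_nonzero [simp]: "prim_root p \<noteq> 0"
  by (simp add: prim_root_def)

lemma prim_root_pow_self: "prim_root p ^ p = 1"
  using p by (simp add: prim_root_pow)

lemma prim_root_pow_mod: "prim_root p ^ (m mod p) = prim_root p ^ m"
  by (metis prim_root_pow_self div_mult_mod_eq mult.commute mult_1 power_add power_mult power_one)

lemma prim_root_pow_eq_1_iff: "prim_root p ^ m = 1 \<longleftrightarrow> p dvd m"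
proof
  assume "prim_root p ^ m = 1"
  then have eq: "cis (2 * pi * real (m mod p) / real p) = cis (2 * pi * real 0 / real p)"
    by (simp add: prim_root_pow_mod flip: prim_root_pow)
  have inj: "inj_on (\<lambda>k. cis (2 * pi * real k / real p)) {..<p}"
    using bij_betw_roots_unity[OF p] by (rule bij_betw_imp_inj_on)
  have "m mod p = 0"
    by (rule inj_onD[OF inj eq]) (use p in auto)
  then show "p dvd m" by auto
qed (auto simp: power_mult prim_root_pow_self)

lemma root_of_unity_is_prim_root_pow:
  assumes "z ^ p = 1"
  obtains k where "z = prim_root p ^ k"
  using bij_betw_roots_unity[OF p] assms that unfolding prim_root_pow bij_betw_def by blast

text \<open>Divisibility of the multiplicative group of complex numbers, on which the splitting of
  abelian extensions rests.\<close>

lemma nth_root_exists: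
  assumes "w \<noteq> (0::complex)"
  obtains z where "z ^ p = w" "z \<noteq> 0"
proof -
  \<comment> \<open>\<open>bij_betw_nth_root_unity\<close> multiplies one fixed root of
    \<open>w\<close> by the roots of unity; the trailing factor \<open>1\<close> is the trivial root
    of unity.\<close>
  have "root p (cmod w) * cis (Arg w / p) * 1 \<in> {z. z ^ p = w}" (is "?z \<in> _")
    using bij_betw_nth_root_unity[OF assms p] by (rule bij_betw_apply) simp
  moreover from this have "?z \<noteq> 0"
    using assms p by (auto simp: power_0_left)
  ultimately show ?thesis
    using that by blast
qed

end

section \<open>Alternating bicharacters and the bicharacter of a cocycle\<close>

locale alternating_bicharacter = comm_group G for G (structure) +
  fixes \<beta> :: "'a \<times> 'a \<Rightarrow> complex"
  assumes bichar: "\<beta> \<in> alternating_bicharacters G"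
begin

lemma nonzero: "g \<in> carrier G \<Longrightarrow> h \<in> carrier G \<Longrightarrow> \<beta> (g, h) \<noteq> 0"
  using bichar by (auto simp: alternating_bicharacters_def hom_def)

lemma mult_left:
  "g \<in> carrier G \<Longrightarrow> g' \<in> carrier G \<Longrightarrow> h \<in> carrier G \<Longrightarrow> \<beta> (g \<otimes> g', h) = \<beta> (g, h) * \<beta> (g', h)"
  using bichar by (auto simp: alternating_bicharacters_def hom_def)

lemma mult_right:
  "g \<in> carrier G \<Longrightarrow> h \<in> carrier G \<Longrightarrow> h' \<in> carrier G \<Longrightarrow> \<beta> (g, h \<otimes> h') = \<beta> (g, h) * \<beta> (g, h')"
  using bichar by (auto simp: alternating_bicharacters_def hom_def)

lemma self: "g \<in> carrier G \<Longrightarrow> \<beta> (g, g) = 1"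
  using bichar by (auto simp: alternating_bicharacters_def)

text \<open>Polarization: in the expansion of the diagonal value at \<open>g \<otimes> h\<close>
  only the two mixed factors survive.\<close>

lemma swap:
  assumes "g \<in> carrier G" "h \<in> carrier G"
  shows "\<beta> (h, g) = inverse (\<beta> (g, h))"
proof -
  have "\<beta> (g, h) * \<beta> (h, g) = \<beta> (g \<otimes> h, g \<otimes> h)"
    using assms by (simp add: mult_left mult_right self[of g] self[of h])
  also have "\<dots> = 1"
    using assms by (intro self) auto
  finally have "\<beta> (g, h) * \<beta> (h, g) = 1" .
  then show ?thesis
    by (rule inverse_unique[symmetric])
qed

lemma one_left [simp]: "h \<in> carrier G \<Longrightarrow> \<beta> (\<one>, h) = 1"
  using mult_left[of \<one> \<one> h] nonzero[of \<one> h] by (metis l_one mult_cancel_right1 one_closed)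

lemma one_right [simp]: "h \<in> carrier G \<Longrightarrow> \<beta> (h, \<one>) = 1"
  using mult_right[of h \<one> \<one>] nonzero[of h \<one>] by (metis l_one mult_cancel_right1 one_closed)

lemma pow_left: "g \<in> carrier G \<Longrightarrow> h \<in> carrier G \<Longrightarrow> \<beta> (g [^] (n::nat), h) = \<beta> (g, h) ^ n"
  by (induction n) (simp_all add: mult_left mult.commute)

lemma pow_right: "g \<in> carrier G \<Longrightarrow> h \<in> carrier G \<Longrightarrow> \<beta> (g, h [^] (n::nat)) = \<beta> (g, h) ^ n"
  by (induction n) (simp_all add: mult_right mult.commute)

text \<open>Lets orthogonality to \<open>y\<close> pass from a set to the subgroup that it
  generates.\<close>

lemma orthogonal_subgroup:
  assumes "y \<in> carrier G"
  shows "subgroup {g \<in> carrier G. \<beta> (g, y) = 1} G"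
proof (rule subgroupI)
  fix g assume "g \<in> {g \<in> carrier G. \<beta> (g, y) = 1}"
  with assms show "inv g \<in> {g \<in> carrier G. \<beta> (g, y) = 1}"
    using mult_left[of g "inv g" y] by simp
qed (use assms in \<open>auto simp: mult_left\<close>)

end

lemma (in comm_group) cocycle_bicharacter_alternating:
  assumes f: "f \<in> cocycles2 G"
  shows "cocycle_bicharacter G f \<in> alternating_bicharacters G"
proof -
  have nz: "f (g, h) \<noteq> 0" if "g \<in> carrier G" "h \<in> carrier G" for g h
    using f that by (auto simp: cocycles2_def)
  have coc: "f (g, h) * f (g \<otimes> h, k) = f (h, k) * f (g, h \<otimes> k)"
    if "g \<in> carrier G" "h \<in> carrier G" "k \<in> carrier G" for g h k
    using f that by (auto simp: cocycles2_def)
  define \<alpha> where "\<alpha> g h = f (g, h) / f (h, g)" for g h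
  have mult: "\<alpha> (g \<otimes> g') h = \<alpha> g h * \<alpha> g' h"
    if g: "g \<in> carrier G" "g' \<in> carrier G" "h \<in> carrier G" for g g' h
  proof -
    have 1: "f (g \<otimes> g', h) = f (g', h) * f (g, g' \<otimes> h) / f (g, g')"
      using coc[OF g] nz g by (simp add: field_simps)
    have 2: "f (h, g \<otimes> g') = f (h, g) * f (h \<otimes> g, g') / f (g, g')"
      using coc[of h g g'] nz g by (simp add: field_simps)
    have 3: "f (g, g' \<otimes> h) = f (g, h) * f (g \<otimes> h, g') / f (h, g')"
      using coc[of g h g'] nz g m_comm[of g' h] by (simp add: field_simps)
    have 4: "h \<otimes> g = g \<otimes> h"
      using g by (simp add: m_comm)
    \<comment> \<open>In the quotient of 1 by 2 the factor \<open>f (g, g')\<close> cancels. After 3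
      and 4 so does \<open>f (g \<otimes> h, g')\<close>, which leaves the product of the two
      ratios.\<close>
    show ?thesis
      unfolding \<alpha>_def 1 2 3 4 using nz g by (simp add: mult.commute)
  qed
  have inv: "\<alpha> h g = inverse (\<alpha> g h)" for g h
    by (simp add: \<alpha>_def)
  have mult': "\<alpha> h (g \<otimes> g') = \<alpha> h g * \<alpha> h g'"
    if "g \<in> carrier G" "g' \<in> carrier G" "h \<in> carrier G" for g g' h
    using mult[OF that] by (simp add: inv[of h])
  show ?thesis
    unfolding cocycle_bicharacter_def divide_inverse[symmetric] \<alpha>_def[symmetric]
    using mult mult' nz
    by (auto simp: alternating_bicharacters_def hom_def \<alpha>_def)
qed

text \<open>Recovers an original generator from its orthogonal projection, which differs from it by
  a factor in the generated subgroup.\<close>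

lemma (in group) generate_of_mult:
  assumes "H \<subseteq> carrier G" "g \<in> carrier G" "h \<in> generate G H" "g \<otimes> h \<in> generate G H"
  shows "g \<in> generate G H"
proof -
  have h: "h \<in> carrier G"
    using generate_incl[OF assms(1)] assms(3) by auto
  have "(g \<otimes> h) \<otimes> inv h \<in> generate G H"
    using assms by (blast intro: generate.eng generate_m_inv_closed)
  then show ?thesis
    using assms(2) h by (simp add: m_assoc)
qed

lemma (in group) generate_pow_closed:
  assumes "H \<subseteq> carrier G" "g \<in> generate G H"
  shows "g [^] (n::nat) \<in> generate G H"
  using assms by (induction n) (auto intro: generate.one generate.eng)

subsection \<open>Symplectic generating families\<close>

context alternating_bicharacter
begin

text \<open>A Darboux family: \<open>n\<close> hyperbolic pairs and a set \<open>C\<close>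
  orthogonal to the pairs and to itself. Mixed values are recorded in one order only;
  \<open>swap\<close> gives the other.\<close>

definition symplectic :: "nat \<Rightarrow> nat \<Rightarrow> (nat \<Rightarrow> 'a) \<Rightarrow> (nat \<Rightarrow> 'a) \<Rightarrow> 'a set \<Rightarrow> bool" where
  "symplectic p n a b C \<longleftrightarrow>
     (\<forall>i<n. \<forall>j<n. \<beta> (a i, a j) = 1 \<and> \<beta> (b i, b j) = 1 \<and>
        \<beta> (a i, b j) = (if i = j then prim_root p else 1)) \<and>
     (\<forall>c\<in>C. \<forall>i<n. \<beta> (a i, c) = 1 \<and> \<beta> (b i, c) = 1) \<and>
     (\<forall>c\<in>C. \<forall>d\<in>C. \<beta> (c, d) = 1)"

lemma bichar_is_prim_root_pow:
  assumes "p > 0" "x \<in> carrier G" "x [^] p = \<one>" "y \<in> carrier G"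
  obtains w where "\<beta> (x, y) = prim_root p ^ w"
proof -
  have "\<beta> (x, y) ^ p = 1"
    using assms by (simp flip: pow_left)
  then show ?thesis
    using root_of_unity_is_prim_root_pow[OF assms(1)] that by blast
qed

text \<open>Since \<open>p\<close> is prime, the exponent \<open>w\<close> of a nontrivial value is
  invertible modulo \<open>p\<close>, and its inverse \<open>k\<close> normalizes the value. The
  second conclusion shows that replacing \<open>y\<close> by its power does not shrink the generated
  subgroup.\<close>

lemma hyperbolic_partner:
  assumes p: "Factorial_Ring.prime p" and "x \<in> carrier G" "y \<in> carrier G"
    "x [^] p = \<one>" "y [^] p = \<one>" "\<beta> (x, y) \<noteq> 1"
  obtains k w :: nat where "\<beta> (x, y [^] k) = prim_root p" "(y [^] k) [^] w = y"
proof -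
  have p0: "p > 0"
    using p by (simp add: prime_gt_0_nat)
  obtain w where w: "\<beta> (x, y) = prim_root p ^ w"
    using assms bichar_is_prim_root_pow[OF p0] by blast
  have "\<not> p dvd w"
    using assms(6) w prim_root_pow_eq_1_iff[OF p0] by simp
  then have "coprime w p"
    using p by (simp add: prime_imp_coprime coprime_commute)
  then obtain k m where km: "w * k = p * m + 1"
    using coprime_bezout_strong[of w p] p by (metis not_prime_1)
  show ?thesis
  proof
    have "\<beta> (x, y [^] k) = prim_root p ^ (w * k)"
      using assms by (simp add: pow_right w power_mult)
    then show "\<beta> (x, y [^] k) = prim_root p"
      by (simp add: km power_add power_mult prim_root_pow_self[OF p0])
    have "(y [^] k) [^] w = y [^] (p * m) \<otimes> y"
      using assms by (simp add: nat_pow_pow mult.commute[of k] km)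
    also have "y [^] (p * m) = \<one>"
      using assms by (simp flip: nat_pow_pow)
    finally show "(y [^] k) [^] w = y"
      using assms by simp
  qed
qed

text \<open>Orthogonal projection along a hyperbolic plane. The exponents are read off from
  \<open>\<beta> (y, z)\<close> and \<open>\<beta> (z, x)\<close>; with these orders of the
  arguments the signs work out so that natural exponents suffice.\<close>

lemma hyperbolic_projection:
  assumes p: "p > 0" and exponent: "\<And>x. x \<in> carrier G \<Longrightarrow> x [^] p = \<one>"
    and "x \<in> carrier G" "y \<in> carrier G" "\<beta> (x, y) = prim_root p" "z \<in> carrier G"
  shows "\<exists>(u::nat) (v::nat). \<beta> (z \<otimes> (x [^] u \<otimes> y [^] v), x) = 1 \<and> \<beta> (z \<otimes> (x [^] u \<otimes> y [^] v), y) = 1"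
proof -
  obtain u where u: "\<beta> (y, z) = prim_root p ^ u"
    using assms bichar_is_prim_root_pow[OF p] by blast
  obtain v where v: "\<beta> (z, x) = prim_root p ^ v"
    using assms bichar_is_prim_root_pow[OF p] by blast
  have "\<beta> (z \<otimes> (x [^] u \<otimes> y [^] v), x) = 1" "\<beta> (z \<otimes> (x [^] u \<otimes> y [^] v), y) = 1"
    using assms p by (simp_all add: mult_left pow_left self v swap[of x y] swap[of y z] u power_inverse)
  then show ?thesis
    by blast
qed

text \<open>
  Linear independence is not tracked: the bound on the number of generators suffices, because a
  family of \<open>s\<close> generators of a group of order \<open>p\<^sup>s\<close> and exponent \<open>p\<close> is a basis.
\<close>

lemma symplectic_generators:
  assumes p: "Factorial_Ring.prime p" and exponent: "\<And>x. x \<in> carrier G \<Longrightarrow> x [^] p = \<one>"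
    and "finite A" "A \<subseteq> carrier G"
  shows "\<exists>n a b C. finite C \<and> 2 * n + card C \<le> card A \<and>
    a ` {..<n} \<union> b ` {..<n} \<union> C \<subseteq> generate G A \<and>
    A \<subseteq> generate G (a ` {..<n} \<union> b ` {..<n} \<union> C) \<and> symplectic p n a b C"
  using assms(3,4)
proof (induction A rule: measure_induct_rule[of card])
  case (less A)
  note A = less.prems
  have p0: "p > 0"
    using p by (simp add: prime_gt_0_nat)
  show ?case
  proof (cases "\<forall>x\<in>A. \<forall>y\<in>A. \<beta> (x, y) = 1")
    case True
    then have "symplectic p 0 (\<lambda>_. \<one>) (\<lambda>_. \<one>) A"
      by (simp add: symplectic_def)
    moreover have "A \<subseteq> generate G A"
      by (auto intro: generate.incl)
    ultimately show ?thesis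
      using A by (intro exI[of _ 0] exI[of _ "\<lambda>_. \<one>"] exI[of _ A]) auto
  next
    case False
    then obtain x z where x: "x \<in> A" and z: "z \<in> A" and xz: "\<beta> (x, z) \<noteq> 1"
      by blast
    note [simp] = subsetD[OF A(2) x] subsetD[OF A(2) z]
    from xz have "x \<noteq> z"
      by (auto simp: self)
    obtain k w :: nat where k: "\<beta> (x, z [^] k) = prim_root p" and w: "(z [^] k) [^] w = z"
      using hyperbolic_partner[OF p _ _ exponent exponent xz] by auto
    define y where "y = z [^] k"
    have y [simp]: "y \<in> carrier G" and xy: "\<beta> (x, y) = prim_root p"
      using k by (auto simp: y_def)
    \<comment> \<open>The two exponents are packed into a pair so that one use of
      \<open>bchoice\<close> supplies them for all \<open>t\<close>.\<close>
    have "\<forall>t\<in>carrier G. \<exists>uv :: nat \<times> nat. \<beta> (t \<otimes> (x [^] fst uv \<otimes> y [^] snd uv), x) = 1 \<and>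
        \<beta> (t \<otimes> (x [^] fst uv \<otimes> y [^] snd uv), y) = 1"
    proof
      fix t assume "t \<in> carrier G"
      with xy have "\<exists>(u::nat) (v::nat). \<beta> (t \<otimes> (x [^] u \<otimes> y [^] v), x) = 1 \<and> \<beta> (t \<otimes> (x [^] u \<otimes> y [^] v), y) = 1"
        by (intro hyperbolic_projection[OF p0 exponent]) auto
      then obtain u v :: nat where "\<beta> (t \<otimes> (x [^] u \<otimes> y [^] v), x) = 1" "\<beta> (t \<otimes> (x [^] u \<otimes> y [^] v), y) = 1"
        by blast
      then show "\<exists>uv :: nat \<times> nat. \<beta> (t \<otimes> (x [^] fst uv \<otimes> y [^] snd uv), x) = 1 \<and>
          \<beta> (t \<otimes> (x [^] fst uv \<otimes> y [^] snd uv), y) = 1"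
        by (intro exI[of _ "(u, v)"]) simp
    qed
    from bchoice[OF this] obtain uv :: "'a \<Rightarrow> nat \<times> nat" where *: "\<forall>t\<in>carrier G.
        \<beta> (t \<otimes> (x [^] fst (uv t) \<otimes> y [^] snd (uv t)), x) = 1 \<and>
        \<beta> (t \<otimes> (x [^] fst (uv t) \<otimes> y [^] snd (uv t)), y) = 1" ..
    define r where "r t = t \<otimes> (x [^] fst (uv t) \<otimes> y [^] snd (uv t))" for t
    have r: "r t \<in> carrier G" "\<beta> (r t, x) = 1" "\<beta> (r t, y) = 1" if "t \<in> carrier G" for t
      using that bspec[OF * that] by (simp_all add: r_def)
    \<comment> \<open>Two elements leave \<open>A\<close>, paid for by the new pair
      \<open>x\<close>, \<open>y\<close>. Projection may identify some of the others but never
      increases their number, so the bound on the size of the family survives.\<close>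
    define A' where "A' = r ` (A - {x, z})"
    have A': "finite A'" "A' \<subseteq> carrier G"
      using A r by (auto simp: A'_def)
    have "card A' \<le> card (A - {x, z})"
      using A by (auto simp: A'_def intro: card_image_le)
    moreover have "card (A - {x, z}) = card A - 2"
      using A x z \<open>x \<noteq> z\<close> by (subst card_Diff_subset) auto
    moreover have "card A \<ge> 2"
      using card_mono[OF A(1), of "{x, z}"] x z \<open>x \<noteq> z\<close> by simp
    ultimately have card: "card A' + 2 \<le> card A"
      by linarith
    then have "card A' < card A"
      by linarith
    from less.IH[OF this A'] obtain n a b C where C: "finite C" "2 * n + card C \<le> card A'"
      and sub: "a ` {..<n} \<union> b ` {..<n} \<union> C \<subseteq> generate G A'"
      and sup: "A' \<subseteq> generate G (a ` {..<n} \<union> b ` {..<n} \<union> C)"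
      and symp: "symplectic p n a b C"
      by blast
    let ?a = "a(n := x)" and ?b = "b(n := y)"
    let ?T' = "a ` {..<n} \<union> b ` {..<n} \<union> C" and ?T = "?a ` {..<Suc n} \<union> ?b ` {..<Suc n} \<union> C"
    have T: "?T = insert x (insert y ?T')"
      by (auto simp: lessThan_Suc)
    have genA: "generate G A \<subseteq> carrier G" and genA': "generate G A' \<subseteq> carrier G"
      using A A' by (auto intro: generate_in_carrier)
    have xA: "x \<in> generate G A" and yA: "y \<in> generate G A"
      using x z A by (auto simp: y_def intro: generate.incl generate_pow_closed)
    have "r t \<in> generate G A" if "t \<in> A" for t
      unfolding r_def using that A(2) xA yA
      by (intro generate.eng generate_pow_closed) (auto intro: generate.incl)
    then have "generate G A' \<subseteq> generate G A"
      using A by (intro generate_subgroup_incl generate_is_subgroup) (auto simp: A'_def)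
    with sub xA yA have subA: "?T \<subseteq> generate G A"
      unfolding T by blast
    then have T_carrier: "?T \<subseteq> carrier G"
      using genA by blast
    have "generate G ?T' \<subseteq> generate G ?T"
      by (intro mono_generate) (unfold T, blast)
    then have supA': "A' \<subseteq> generate G ?T"
      using sup by blast
    have xT: "x \<in> generate G ?T" and yT: "y \<in> generate G ?T"
      unfolding T by (auto intro: generate.incl)
    have supA: "A \<subseteq> generate G ?T"
    proof
      fix t assume t: "t \<in> A"
      consider "t = x" | "t = z" | "t \<in> A - {x, z}"
        using t by blast
      then show "t \<in> generate G ?T"
      proof cases
        case 1
        with xT show ?thesis by (simp only:)
      next
        case 2
        \<comment> \<open>\<open>z\<close> has been replaced by its partner \<open>y\<close> and
          comes back as a power of it.\<close>
        have "y [^] w = z"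
          unfolding y_def by (fact w)
        with generate_pow_closed[OF T_carrier yT, of w] 2 show ?thesis
          by (simp only:)
      next
        case 3
        then have "r t \<in> generate G ?T"
          using supA' by (auto simp: A'_def)
        then show ?thesis
          unfolding r_def
          by (rule generate_of_mult[OF T_carrier subsetD[OF A(2) t]
                generate.eng[OF generate_pow_closed[OF T_carrier xT] generate_pow_closed[OF T_carrier yT]]])
      qed
    qed
    \<comment> \<open>The family from the induction hypothesis lies in the subgroup generated by the
      projections, so it inherits their orthogonality to \<open>x\<close> and
      \<open>y\<close>.\<close>
    have "A' \<subseteq> {g \<in> carrier G. \<beta> (g, t) = 1}" if "t \<in> {x, y}" for t
      using that A(2) r by (auto simp: A'_def)
    then have "generate G A' \<subseteq> {g \<in> carrier G. \<beta> (g, t) = 1}" if "t \<in> {x, y}" for t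
      using that by (intro generate_subgroup_incl orthogonal_subgroup) auto
    then have orth: "\<beta> (g, x) = 1" "\<beta> (g, y) = 1" if "g \<in> ?T'" for g
      using that sub by blast+
    have orth': "\<beta> (x, g) = 1" "\<beta> (y, g) = 1" if "g \<in> ?T'" for g
    proof -
      have "g \<in> carrier G"
        using that T_carrier unfolding T by blast
      then show "\<beta> (x, g) = 1" "\<beta> (y, g) = 1"
        using orth[OF that] swap[of g x] swap[of g y] by simp_all
    qed
    have "symplectic p (Suc n) ?a ?b C"
      using symp orth orth' xy by (auto simp: symplectic_def less_Suc_eq self)
    moreover have "2 * Suc n + card C \<le> card A"
      using C card by simp
    ultimately show ?thesis
      by (rule_tac exI[where x = "Suc n"], rule_tac exI[where x = ?a],
          rule_tac exI[where x = ?b], rule_tac exI[where x = C])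
        (intro conjI C(1) subA supA)
  qed
qed

end

lemma hom_finprod:
  assumes "comm_group G" "comm_group H" "h \<in> hom G H" "x \<in> A \<rightarrow> carrier G" "finite A"
  shows "h (finprod G x A) = finprod H (\<lambda>i. h (x i)) A"
proof -
  interpret G: comm_group G by fact
  interpret H: comm_group H by fact
  have h: "h g \<in> carrier H" if "g \<in> carrier G" for g
    using assms(3) that by (auto simp: hom_def)
  have one: "h \<one>\<^bsub>G\<^esub> = \<one>\<^bsub>H\<^esub>"
    using assms(3) by (rule hom_one) unfold_locales
  show ?thesis
    using assms(5,4)
  proof (induction A rule: finite_induct)
    case (insert i A)
    then show ?case
      using assms(3) h by (simp add: hom_mult[of h G H] Pi_iff)
  qed (simp add: one)
qed

text \<open>Makes powers with a coordinate as exponent well behaved, although coordinates are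
  controlled only modulo \<open>p\<close>.\<close>

lemma (in group) pow_eq_of_mod_eq:
  assumes "x \<in> carrier G" "x [^] (p::nat) = \<one>" "m mod p = n mod p"
  shows "x [^] m = x [^] n"
proof -
  have "x [^] k = x [^] (k mod p)" for k :: nat
  proof -
    have "x [^] k = x [^] (p * (k div p) + k mod p)"
      by simp
    also have "\<dots> = (x [^] p) [^] (k div p) \<otimes> x [^] (k mod p)"
      using assms(1) by (simp only: nat_pow_mult nat_pow_pow)
    finally show ?thesis
      using assms by simp
  qed
  then show ?thesis
    using assms(3) by metis
qed

subsection \<open>Elementary abelian groups in coordinates\<close>

text \<open>A vector space over the field with \<open>p\<close> elements, given by a basis and its
  dual basis. \<open>expand\<close> says that the generators span; \<open>coord_mult\<close> and
  \<open>coord_gen\<close> say that the coordinates are additive modulo \<open>p\<close> and dual to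
  the generators, which carries their independence.\<close>

locale elementary_abelian = comm_group G for G (structure) +
  fixes p s :: nat and \<sigma> :: "nat \<Rightarrow> 'a" and coord :: "'a \<Rightarrow> nat \<Rightarrow> nat"
  assumes p_prime: "Factorial_Ring.prime p"
    and finite_carrier: "finite (carrier G)"
    and gen_closed [simp]: "j \<in> {1..s} \<Longrightarrow> \<sigma> j \<in> carrier G"
    and gen_pow: "j \<in> {1..s} \<Longrightarrow> \<sigma> j [^] p = \<one>"
    and expand: "g \<in> carrier G \<Longrightarrow> g = (\<Otimes>j\<in>{1..s}. \<sigma> j [^] coord g j)"
    and coord_mult: "g \<in> carrier G \<Longrightarrow> h \<in> carrier G \<Longrightarrow> j \<in> {1..s} \<Longrightarrow>
          coord (g \<otimes> h) j mod p = (coord g j + coord h j) mod p"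
    and coord_gen: "j \<in> {1..s} \<Longrightarrow> l \<in> {1..s} \<Longrightarrow>
          coord (\<sigma> j) l mod p = (if l = j then 1 else 0)"
begin

lemma p_pos: "p > 0"
  using p_prime by (simp add: prime_gt_0_nat)

lemma hom_eqI:
  assumes "comm_group E" "h \<in> hom G E" "h' \<in> hom G E" "g \<in> carrier G"
    "\<And>j. j \<in> {1..s} \<Longrightarrow> h (\<sigma> j) = h' (\<sigma> j)"
  shows "h g = h' g"
proof -
  interpret E: comm_group E by fact
  have *: "k g = finprod E (\<lambda>j. k (\<sigma> j) [^]\<^bsub>E\<^esub> coord g j) {1..s}" if k: "k \<in> hom G E" for k
  proof -
    have "k g = k (\<Otimes>j\<in>{1..s}. \<sigma> j [^] coord g j)"
      using expand[OF assms(4)] by simp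
    also have "\<dots> = finprod E (\<lambda>j. k (\<sigma> j [^] coord g j)) {1..s}"
      by (rule hom_finprod[OF comm_group_axioms assms(1) k]) auto
    also have "\<dots> = finprod E (\<lambda>j. k (\<sigma> j) [^]\<^bsub>E\<^esub> coord g j) {1..s}"
      using k by (intro E.finprod_cong') (auto simp: hom_nat_pow[OF k _ is_group E.is_group] hom_def)
    finally show ?thesis .
  qed
  show ?thesis
    unfolding *[OF assms(2)] *[OF assms(3)]
    using assms(3,5) by (intro E.finprod_cong') (auto simp: hom_def)
qed

text \<open>The candidate for the homomorphism with values \<open>v\<close> on the generators. The
  target \<open>E\<close> is left general because it will be the group itself, for automorphisms,
  and a central extension, for its section.\<close>

definition lift :: "('e, 'f) monoid_scheme \<Rightarrow> (nat \<Rightarrow> 'e) \<Rightarrow> 'a \<Rightarrow> 'e" where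
  "lift E v g = finprod E (\<lambda>j. v j [^]\<^bsub>E\<^esub> coord g j) {1..s}"

context
  fixes E :: "('e, 'f) monoid_scheme" and v :: "nat \<Rightarrow> 'e"
  assumes E: "comm_group E"
    and v_closed: "v \<in> {1..s} \<rightarrow> carrier E"
    and v_pow: "\<And>j. j \<in> {1..s} \<Longrightarrow> v j [^]\<^bsub>E\<^esub> p = \<one>\<^bsub>E\<^esub>"
begin

interpretation E: comm_group E by (rule E)

lemmas v = funcset_mem[OF v_closed] v_pow

lemma lift_hom: "lift E v \<in> hom G E"
proof (rule homI)
  fix g h assume g: "g \<in> carrier G" "h \<in> carrier G"
  have "lift E v (g \<otimes> h) = finprod E (\<lambda>j. v j [^]\<^bsub>E\<^esub> coord g j \<otimes>\<^bsub>E\<^esub> v j [^]\<^bsub>E\<^esub> coord h j) {1..s}"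
    unfolding lift_def
  proof (rule E.finprod_cong')
    fix j assume j: "j \<in> {1..s}"
    then show "v j [^]\<^bsub>E\<^esub> coord (g \<otimes> h) j = v j [^]\<^bsub>E\<^esub> coord g j \<otimes>\<^bsub>E\<^esub> v j [^]\<^bsub>E\<^esub> coord h j"
      using v E.pow_eq_of_mod_eq[OF v(1)[OF j] v(2)[OF j] coord_mult[OF g j]]
      by (simp add: E.nat_pow_mult)
  qed (use v in auto)
  also have "\<dots> = lift E v g \<otimes>\<^bsub>E\<^esub> lift E v h"
    unfolding lift_def using v by (intro E.finprod_multf) auto
  finally show "lift E v (g \<otimes> h) = lift E v g \<otimes>\<^bsub>E\<^esub> lift E v h" .
next
  fix g show "lift E v g \<in> carrier E"
    unfolding lift_def using v by (intro E.finprod_closed) auto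
qed

lemma lift_gen:
  assumes "l \<in> {1..s}"
  shows "lift E v (\<sigma> l) = v l"
proof -
  have "lift E v (\<sigma> l) = finprod E (\<lambda>j. if j = l then v j else \<one>\<^bsub>E\<^esub>) {1..s}"
    unfolding lift_def
  proof (rule E.finprod_cong')
    fix j assume j: "j \<in> {1..s}"
    have "1 mod p = 1"
      using prime_gt_1_nat[OF p_prime] by simp
    then have "coord (\<sigma> l) j mod p = (if j = l then 1 else 0) mod p"
      using coord_gen[OF assms j] by simp
    from E.pow_eq_of_mod_eq[OF v(1)[OF j] v(2)[OF j] this]
    show "v j [^]\<^bsub>E\<^esub> coord (\<sigma> l) j = (if j = l then v j else \<one>\<^bsub>E\<^esub>)"
      using v(1)[OF j] v(1)[OF assms] by auto
  qed (use v in auto)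
  also have "\<dots> = v l"
    using v assms by (intro E.finprod_singleton_swap) auto
  finally show ?thesis .
qed

end

text \<open>The \<open>p\<close>-th power map of an abelian group is an endomorphism, here trivial
  on generators.\<close>

lemma exponent:
  assumes "g \<in> carrier G"
  shows "g [^] p = \<one>"
proof (rule hom_eqI[OF comm_group_axioms _ _ assms])
  show "(\<lambda>g. g [^] p) \<in> hom G G" "(\<lambda>g. \<one>) \<in> hom G G"
    by (auto simp: hom_def nat_pow_distrib)
qed (simp add: gen_pow)

lemma generate_gens: "generate G (\<sigma> ` {1..s}) = carrier G"
proof
  show "generate G (\<sigma> ` {1..s}) \<subseteq> carrier G"
    by (intro generate_incl) auto
  show "carrier G \<subseteq> generate G (\<sigma> ` {1..s})"
  proof
    fix g assume "g \<in> carrier G"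
    have "(\<Otimes>j\<in>J. \<sigma> j [^] coord g j) \<in> generate G (\<sigma> ` {1..s})" if "J \<subseteq> {1..s}" for J
      using finite_subset[OF that finite_atLeastAtMost] that
    proof (induction J rule: finite_induct)
      case (insert j J)
      then have "(\<Otimes>j\<in>insert j J. \<sigma> j [^] coord g j) = \<sigma> j [^] coord g j \<otimes> (\<Otimes>j\<in>J. \<sigma> j [^] coord g j)"
        by (intro finprod_insert) auto
      moreover have "\<sigma> j [^] coord g j \<in> generate G (\<sigma> ` {1..s})"
        using insert.prems by (intro generate_pow_closed generate.incl) auto
      moreover have "(\<Otimes>j\<in>J. \<sigma> j [^] coord g j) \<in> generate G (\<sigma> ` {1..s})"
        using insert by blast
      ultimately show ?case
        by (simp only: generate.eng)
    qed (simp add: generate.one)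
    from this[OF order.refl] show "g \<in> generate G (\<sigma> ` {1..s})"
      using expand[OF \<open>g \<in> carrier G\<close>] by simp
  qed
qed

text \<open>The image is a subgroup containing a generating family, so the endomorphism is onto;
  finiteness makes it injective. This is how \<open>s\<close> generators act as a basis.\<close>

lemma lift_iso:
  assumes v: "v \<in> {1..s} \<rightarrow> carrier G" and gen: "carrier G \<subseteq> generate G (v ` {1..s})"
  shows "lift G v \<in> iso G G"
proof -
  have v': "\<And>j. j \<in> {1..s} \<Longrightarrow> v j [^] p = \<one>"
    using exponent funcset_mem[OF v] by blast
  have hom: "lift G v \<in> hom G G"
    by (rule lift_hom[OF comm_group_axioms v v'])
  then interpret group_hom G G "lift G v"
    by unfold_locales
  have "v ` {1..s} \<subseteq> lift G v ` carrier G"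
  proof (rule image_subsetI)
    fix j assume j: "j \<in> {1..s}"
    show "v j \<in> lift G v ` carrier G"
      by (rule image_eqI[where x = "\<sigma> j"])
        (use j in \<open>simp_all only: lift_gen[OF comm_group_axioms v v'] gen_closed\<close>)
  qed
  then have "generate G (v ` {1..s}) \<subseteq> lift G v ` carrier G"
    by (intro generate_subgroup_incl img_is_subgroup)
  with gen have surj: "lift G v ` carrier G = carrier G"
    using hom_closed by blast
  then have "inj_on (lift G v) (carrier G)"
    by (intro eq_card_imp_inj_on finite_carrier) simp
  with surj hom show ?thesis
    by (simp add: iso_def bij_betw_def)
qed

text \<open>Alternation extends the agreement from \<open>j < l\<close> to all pairs of generators;
  uniqueness of homomorphisms is then used in one argument at a time.\<close>

lemma bicharacter_eqI:
  assumes "\<alpha> \<in> alternating_bicharacters G" "\<beta> \<in> alternating_bicharacters G"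
    and eq: "\<And>j l. j \<in> {1..s} \<Longrightarrow> l \<in> {1..s} \<Longrightarrow> j < l \<Longrightarrow> \<alpha> (\<sigma> j, \<sigma> l) = \<beta> (\<sigma> j, \<sigma> l)"
  shows "\<alpha> = \<beta>"
proof -
  interpret \<alpha>: alternating_bicharacter G \<alpha> by unfold_locales fact
  interpret \<beta>: alternating_bicharacter G \<beta> by unfold_locales fact
  have eq': "\<alpha> (\<sigma> j, \<sigma> l) = \<beta> (\<sigma> j, \<sigma> l)" if "j \<in> {1..s}" "l \<in> {1..s}" for j l
  proof -
    consider "j < l" | "j = l" | "l < j" by linarith
    then show ?thesis
    proof cases
      case 1
      with eq that show ?thesis by blast
    next
      case 2
      with that show ?thesis by (simp add: \<alpha>.self \<beta>.self)
    next
      case 3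
      have "\<alpha> (\<sigma> j, \<sigma> l) = inverse (\<alpha> (\<sigma> l, \<sigma> j))" "\<beta> (\<sigma> j, \<sigma> l) = inverse (\<beta> (\<sigma> l, \<sigma> j))"
        using that by (auto intro: \<alpha>.swap \<beta>.swap)
      with eq[OF that(2,1) 3] show ?thesis by simp
    qed
  qed
  have hom: "(\<lambda>g. \<gamma> (g, h)) \<in> hom G cplx_mult" "(\<lambda>g. \<gamma> (h, g)) \<in> hom G cplx_mult"
    if "\<gamma> \<in> {\<alpha>, \<beta>}" "h \<in> carrier G" for \<gamma> h
    using that assms(1,2) by (auto simp: alternating_bicharacters_def)
  have "\<alpha> (\<sigma> j, h) = \<beta> (\<sigma> j, h)" if "h \<in> carrier G" "j \<in> {1..s}" for j h
    using eq'[OF that(2)] that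
    by (rule_tac hom_eqI[OF comm_group_cplx_mult, of "\<lambda>x. \<alpha> (\<sigma> j, x)" "\<lambda>x. \<beta> (\<sigma> j, x)"])
      (auto intro: hom)
  then have "\<alpha> (g, h) = \<beta> (g, h)" if "g \<in> carrier G" "h \<in> carrier G" for g h
    using that
    by (rule_tac hom_eqI[OF comm_group_cplx_mult, of "\<lambda>x. \<alpha> (x, h)" "\<lambda>x. \<beta> (x, h)"])
      (auto intro: hom)
  moreover have "\<alpha> \<in> extensional (carrier G \<times> carrier G)" "\<beta> \<in> extensional (carrier G \<times> carrier G)"
    using assms(1,2) by (auto simp: alternating_bicharacters_def)
  ultimately show ?thesis
    by (intro extensionalityI) auto
qed

end

lemma (in group) pow_eq_imp_mod_eq:
  assumes "x \<in> carrier G" "x [^] (m::nat) = x [^] (n::nat)"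
  shows "m mod ord x = n mod ord x"
proof -
  have "int (ord x) dvd int n - int m"
    using assms int_pow_eq[of x "int m" "int n"] by (simp add: int_pow_int)
  then have "int n mod int (ord x) = int m mod int (ord x)"
    by (simp add: mod_eq_dvd_iff)
  then show ?thesis
    by (metis of_nat_eq_iff of_nat_mod)
qed

text \<open>The inverse of the product isomorphism splits an element into components in the cyclic
  factors. A coordinate is any exponent representing such a component; it is unique modulo
  \<open>p\<close> because the generator has order \<open>p\<close>.\<close>

lemma elementary_abelian_of_direct_product_cyclic:
  fixes G (structure)
  assumes p: "Factorial_Ring.prime p" and dp: "direct_product_cyclic G p s \<sigma>"
  obtains coord where "elementary_abelian G p s \<sigma> coord"
proof -
  define K where "K j = subgroup_generated G {\<sigma> j}" for j
  define \<Phi> where "\<Phi> x = finprod G x {1..s}" for x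
  define P where "P = product_group {1..s} K"
  interpret comm_group G
    using dp by (simp add: direct_product_cyclic_def)
  have \<sigma>: "\<sigma> j \<in> carrier G" and ord_K: "Coset.order (K j) = p" if "j \<in> {1..s}" for j
    using dp that by (auto simp: direct_product_cyclic_def K_def)
  have ord: "ord (\<sigma> j) = p" if "j \<in> {1..s}" for j
    using ord_K[OF that] cyclic_order_is_ord[OF \<sigma>[OF that]] by (simp add: K_def)
  have p0: "p > 0"
    using p by (simp add: prime_gt_0_nat)
  have \<Phi>: "\<Phi> \<in> iso P G"
    using dp unfolding direct_product_cyclic_def \<Phi>_def[abs_def] P_def K_def[abs_def] by blast
  have carrier_P: "carrier P = (\<Pi>\<^sub>E j\<in>{1..s}. carrier (K j))"
    by (simp add: P_def)
  have K_sub: "carrier (K j) \<subseteq> carrier G" for j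
    unfolding K_def by (rule carrier_subgroup_generated_subset)
  have "group P"
    unfolding P_def by (rule product_group) (simp add: K_def)
  define \<Psi> where "\<Psi> = inv_into (carrier P) \<Phi>"
  have \<Psi>: "\<Psi> \<in> iso G P"
    unfolding \<Psi>_def by (rule group.iso_set_sym[OF \<open>group P\<close> \<Phi>])
  have \<Psi>_hom: "\<Psi> (g \<otimes> h) j = \<Psi> g j \<otimes> \<Psi> h j"
    if "g \<in> carrier G" "h \<in> carrier G" "j \<in> {1..s}" for g h j
  proof -
    have "\<Psi> (g \<otimes> h) = \<Psi> g \<otimes>\<^bsub>P\<^esub> \<Psi> h"
      using \<Psi> that by (auto simp: iso_def hom_def)
    then show ?thesis
      using that(3) by (simp add: P_def K_def)
  qed
  have "bij_betw \<Phi> (carrier P) (carrier G)"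
    using \<Phi> by (auto simp: iso_def)
  note \<Phi>_\<Psi> = bij_betw_inv_into_right[OF this, folded \<Psi>_def]
    and \<Psi>_\<Phi> = bij_betw_inv_into_left[OF this, folded \<Psi>_def]
  have \<Psi>_mem: "\<Psi> g \<in> carrier P" if "g \<in> carrier G" for g
    using \<Psi> that by (auto simp: iso_def hom_def)
  have "\<exists>k::nat. \<sigma> j [^] k = \<Psi> g j" if g: "g \<in> carrier G" and j: "j \<in> {1..s}" for g j
  proof -
    have "\<Psi> g j \<in> carrier (K j)"
      using \<Psi>_mem[OF g] j unfolding carrier_P by (rule PiE_mem)
    also have "carrier (K j) = generate G {\<sigma> j}"
      using \<sigma>[OF j] by (simp add: K_def carrier_subgroup_generated)
    also have "\<dots> = {\<sigma> j [^] k |k. k \<in> (UNIV :: nat set)}"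
      using \<sigma>[OF j] ord[OF j] p0 by (intro generate_pow_nat) auto
    finally show ?thesis
      by auto
  qed
  then obtain coord :: "'a \<Rightarrow> nat \<Rightarrow> nat" where coord:
    "\<And>g j. g \<in> carrier G \<Longrightarrow> j \<in> {1..s} \<Longrightarrow> \<sigma> j [^] coord g j = \<Psi> g j"
    by metis
  have mod_eq: "m mod p = n mod p" if "j \<in> {1..s}" "\<sigma> j [^] m = \<sigma> j [^] n" for j and m n :: nat
    using pow_eq_imp_mod_eq[OF \<sigma>[OF that(1)] that(2)] ord[OF that(1)] by simp
  have "elementary_abelian G p s \<sigma> coord"
  proof (unfold_locales)
    show "Factorial_Ring.prime p" by (rule p)
    have "finite (carrier (K j))" if "j \<in> {1..s}" for j
      using ord_K[OF that] p0 by (intro card_ge_0_finite) (simp add: Coset.order_def)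
    then have "finite (carrier P)"
      unfolding carrier_P by (intro finite_PiE) auto
    then show "finite (carrier G)"
      using \<Phi> by (auto simp: iso_def dest: bij_betw_finite)
    show "\<sigma> j \<in> carrier G" if "j \<in> {1..s}" for j
      by (rule \<sigma>[OF that])
    show "\<sigma> j [^] p = \<one>" if "j \<in> {1..s}" for j
      using pow_ord_eq_1[OF \<sigma>[OF that]] ord[OF that] by simp
    show "g = (\<Otimes>j\<in>{1..s}. \<sigma> j [^] coord g j)" if g: "g \<in> carrier G" for g
    proof -
      have "(\<Otimes>j\<in>{1..s}. \<sigma> j [^] coord g j) = \<Phi> (\<Psi> g)"
        unfolding \<Phi>_def using \<Psi>_mem[OF g] K_sub
        by (intro finprod_cong') (auto simp: coord[OF g] carrier_P)
      then show ?thesis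
        using \<Phi>_\<Psi>[OF g] by simp
    qed
    show "coord (g \<otimes> h) j mod p = (coord g j + coord h j) mod p"
      if g: "g \<in> carrier G" and h: "h \<in> carrier G" and j: "j \<in> {1..s}" for g h j
      using \<sigma>[OF j] g h j by (intro mod_eq[OF j]) (simp add: coord \<Psi>_hom flip: nat_pow_mult)
    show "coord (\<sigma> j) l mod p = (if l = j then 1 else 0)" if j: "j \<in> {1..s}" and l: "l \<in> {1..s}" for j l
    proof -
      \<comment> \<open>The tuple with the generator in position \<open>j\<close> and the identity
        elsewhere; its product is \<open>\<sigma> j\<close>, so it is the list of components of
        \<open>\<sigma> j\<close>.\<close>
      define x where "x = (\<lambda>l\<in>{1..s}. if l = j then \<sigma> l else \<one>)"
      have "\<Phi> x = (\<Otimes>l\<in>{1..s}. if l = j then \<sigma> l else \<one>)"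
        unfolding \<Phi>_def by (intro finprod_cong') (use \<sigma> in \<open>auto simp: x_def\<close>)
      also have "\<dots> = \<sigma> j"
        using j \<sigma> by (intro finprod_singleton_swap) auto
      finally have \<Phi>x: "\<Phi> x = \<sigma> j" .
      have "\<sigma> l \<in> carrier (K l)" "\<one> \<in> carrier (K l)" if "l \<in> {1..s}" for l
        using \<sigma>[OF that] by (auto simp: K_def carrier_subgroup_generated intro: generate.incl generate.one)
      then have "x \<in> carrier P"
        unfolding carrier_P x_def by auto
      then have "\<Psi> (\<sigma> j) = x"
        using \<Psi>_\<Phi> \<Phi>x by metis
      then have "\<sigma> l [^] coord (\<sigma> j) l = \<sigma> l [^] (if l = j then 1 else 0 :: nat)"
        using coord[OF \<sigma>[OF j] l] \<sigma>[OF l] l by (auto simp: x_def)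
      from mod_eq[OF l this] show ?thesis
        using prime_gt_1_nat[OF p] by auto
    qed
  qed
  then show ?thesis
    by (rule that)
qed

subsection \<open>The standard cocycles\<close>

context elementary_abelian
begin

text \<open>The exponent is one triangular half of the symplectic form of rank \<open>2 * i\<close>.
  Its antisymmetrization is the whole form, without a division by two, so \<open>p = 2\<close> is
  covered as well.\<close>

definition standard_cocycle :: "nat \<Rightarrow> 'a \<times> 'a \<Rightarrow> complex" where
  "standard_cocycle i = (\<lambda>(g, h)\<in>carrier G \<times> carrier G.
     prim_root p ^ (\<Sum>j\<in>{1..i}. coord g j * coord h (j + i)))"

lemma prim_root_pow_cong: "m mod p = n mod p \<Longrightarrow> prim_root p ^ m = prim_root p ^ n"
  by (metis prim_root_pow_mod p_pos)

lemma prim_root_sum_cong: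
  assumes "\<And>j. j \<in> J \<Longrightarrow> f j mod p = f' j mod p"
  shows "prim_root p ^ (\<Sum>j\<in>J. f j :: nat) = prim_root p ^ (\<Sum>j\<in>J. f' j)"
proof (rule prim_root_pow_cong)
  have "(\<Sum>j\<in>J. f j) mod p = (\<Sum>j\<in>J. f j mod p) mod p"
    by (simp add: mod_sum_eq)
  also have "\<dots> = (\<Sum>j\<in>J. f' j mod p) mod p"
    using assms by simp
  finally show "(\<Sum>j\<in>J. f j) mod p = (\<Sum>j\<in>J. f' j) mod p"
    by (simp add: mod_sum_eq)
qed

context
  fixes i assumes i: "2 * i \<le> s"
begin

lemma standard_cocycle_nonzero: "g \<in> carrier G \<Longrightarrow> h \<in> carrier G \<Longrightarrow> standard_cocycle i (g, h) \<noteq> 0"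
  by (simp add: standard_cocycle_def p_pos)

lemma standard_cocycle_mult_left:
  assumes "g \<in> carrier G" "g' \<in> carrier G" "h \<in> carrier G"
  shows "standard_cocycle i (g \<otimes> g', h) = standard_cocycle i (g, h) * standard_cocycle i (g', h)"
proof -
  have "(coord (g \<otimes> g') j * coord h (j + i)) mod p = ((coord g j + coord g' j) * coord h (j + i)) mod p"
    if "j \<in> {1..i}" for j
    using i that coord_mult[OF assms(1,2), of j] by (intro mod_mult_cong) auto
  from prim_root_sum_cong[OF this, of "{1..i}"] show ?thesis
    using assms by (simp add: standard_cocycle_def power_add sum.distrib distrib_right)
qed

lemma standard_cocycle_mult_right:
  assumes "g \<in> carrier G" "h \<in> carrier G" "h' \<in> carrier G"
  shows "standard_cocycle i (g, h \<otimes> h') = standard_cocycle i (g, h) * standard_cocycle i (g, h')"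
proof -
  have "(coord g j * coord (h \<otimes> h') (j + i)) mod p = (coord g j * (coord h (j + i) + coord h' (j + i))) mod p"
    if "j \<in> {1..i}" for j
    using i that coord_mult[OF assms(2,3), of "j + i"] by (intro mod_mult_cong) auto
  from prim_root_sum_cong[OF this, of "{1..i}"] show ?thesis
    using assms by (simp add: standard_cocycle_def power_add sum.distrib distrib_left)
qed

text \<open>A function multiplicative in both arguments is a cocycle: each side of the identity
  expands to the product of its values at \<open>(g, h)\<close>, \<open>(g, k)\<close> and
  \<open>(h, k)\<close>.\<close>

lemma standard_cocycle_in_cocycles2: "standard_cocycle i \<in> cocycles2 G"
proof -
  have "standard_cocycle i \<in> extensional (carrier G \<times> carrier G)"
    by (simp add: standard_cocycle_def)
  then show ?thesis
    by (auto simp: cocycles2_def PiE_def standard_cocycle_nonzero standard_cocycle_mult_left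
        standard_cocycle_mult_right)
qed

lemma coord_gen_mod: "j \<in> {1..s} \<Longrightarrow> l \<in> {1..s} \<Longrightarrow> coord (\<sigma> j) l mod p = (if l = j then 1 else 0) mod p"
  using coord_gen[of j l] prime_gt_1_nat[OF p_prime] by auto

lemma standard_cocycle_gen_left:
  assumes "j \<in> {1..s}" "h \<in> carrier G"
  shows "standard_cocycle i (\<sigma> j, h) = (if j \<le> i then prim_root p ^ coord h (j + i) else 1)"
proof -
  have "(coord (\<sigma> j) l * coord h (l + i)) mod p = ((if l = j then 1 else 0) * coord h (l + i)) mod p"
    if "l \<in> {1..i}" for l
    using i that assms by (intro mod_mult_cong coord_gen_mod) auto
  from prim_root_sum_cong[OF this, of "{1..i}"]
  have "standard_cocycle i (\<sigma> j, h) = prim_root p ^ (\<Sum>l\<in>{1..i}. (if l = j then 1 else 0) * coord h (l + i))"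
    using assms by (simp add: standard_cocycle_def)
  also have "(\<Sum>l\<in>{1..i}. (if l = j then 1 else 0) * coord h (l + i)) =
      (\<Sum>l\<in>{1..i}. if l = j then coord h (l + i) else 0)"
    by (intro sum.cong) auto
  also have "\<dots> = (if j \<le> i then coord h (j + i) else 0)"
    using assms(1) by simp
  finally show ?thesis
    by simp
qed

lemma standard_cocycle_gen_right:
  assumes "l \<in> {1..s}" "g \<in> carrier G"
  shows "standard_cocycle i (g, \<sigma> l) = (if i < l \<and> l \<le> 2 * i then prim_root p ^ coord g (l - i) else 1)"
proof -
  have "(coord g j * coord (\<sigma> l) (j + i)) mod p = (coord g j * (if j + i = l then 1 else 0)) mod p"
    if "j \<in> {1..i}" for j
    using i that assms by (intro mod_mult_cong coord_gen_mod) auto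
  from prim_root_sum_cong[OF this, of "{1..i}"]
  have "standard_cocycle i (g, \<sigma> l) = prim_root p ^ (\<Sum>j\<in>{1..i}. coord g j * (if j + i = l then 1 else 0))"
    using assms by (simp add: standard_cocycle_def)
  also have "(\<Sum>j\<in>{1..i}. coord g j * (if j + i = l then 1 else 0)) =
      (\<Sum>j\<in>{1..i}. if j = l - i then (if i < l then coord g j else 0) else 0)"
    by (intro sum.cong) auto
  also have "\<dots> = (if i < l \<and> l \<le> 2 * i then coord g (l - i) else 0)"
    by auto
  finally show ?thesis
    by simp
qed

definition standard_bicharacter :: "'a \<times> 'a \<Rightarrow> complex" where
  "standard_bicharacter = cocycle_bicharacter G (standard_cocycle i)"

lemma standard_bicharacter_alternating: "standard_bicharacter \<in> alternating_bicharacters G"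
  unfolding standard_bicharacter_def
  by (rule cocycle_bicharacter_alternating[OF standard_cocycle_in_cocycles2])

text \<open>Generators with index above \<open>i\<close> and up to \<open>2 * i\<close> are seen
  only by the second argument of the standard cocycle, those with index up to \<open>i\<close> only
  by the first, and the rest by neither.\<close>

lemma standard_bicharacter_gen:
  assumes "l \<in> {1..s}" "g \<in> carrier G"
  shows "standard_bicharacter (g, \<sigma> l) =
    (if i < l \<and> l \<le> 2 * i then prim_root p ^ coord g (l - i)
     else if l \<le> i then inverse (prim_root p ^ coord g (l + i)) else 1)"
  using assms
  by (auto simp: standard_bicharacter_def cocycle_bicharacter_def standard_cocycle_gen_left
      standard_cocycle_gen_right)

lemma alpha_values_standard_bicharacter: "alpha_values p s \<sigma> i standard_bicharacter"
  unfolding alpha_values_def prim_root_def[symmetric]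
proof (intro ballI impI)
  fix j l assume jl: "j \<in> {1..s}" "l \<in> {1..s}" "j < l"
  have *: "prim_root p ^ coord (\<sigma> j) m = prim_root p ^ (if m = j then 1 else 0)" if "m \<in> {1..s}" for m
    using that jl by (intro prim_root_pow_cong coord_gen_mod)
  show "standard_bicharacter (\<sigma> j, \<sigma> l) = (if 1 \<le> j \<and> j \<le> i \<and> l = j + i then prim_root p else 1)"
  proof (cases "i < l \<and> l \<le> 2 * i")
    case True
    then have "l - i \<in> {1..s}" "l - i = j \<longleftrightarrow> l = j + i" "l = j + i \<Longrightarrow> j \<le> i"
      using jl by auto
    with jl True show ?thesis
      by (auto simp: standard_bicharacter_gen[OF jl(2)] *)
  next
    case False
    \<comment> \<open>\<open>j < l\<close> rules out \<open>l + i = j\<close>, so this coordinate of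
      \<open>\<sigma> j\<close> vanishes modulo \<open>p\<close>.\<close>
    have "prim_root p ^ coord (\<sigma> j) (l + i) = 1" if "l \<le> i"
      using jl i that by (subst *) auto
    with jl False show ?thesis
      by (auto simp: standard_bicharacter_gen[OF jl(2)])
  qed
qed

lemma alpha_values_unique: "\<exists>!\<alpha>. \<alpha> \<in> alternating_bicharacters G \<and> alpha_values p s \<sigma> i \<alpha>"
proof (rule ex1I)
  show "standard_bicharacter \<in> alternating_bicharacters G \<and> alpha_values p s \<sigma> i standard_bicharacter"
    using standard_bicharacter_alternating alpha_values_standard_bicharacter by blast
  fix \<alpha> assume "\<alpha> \<in> alternating_bicharacters G \<and> alpha_values p s \<sigma> i \<alpha>"
  then show "\<alpha> = standard_bicharacter"
    using standard_bicharacter_alternating alpha_values_standard_bicharacter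
    by (intro bicharacter_eqI) (auto simp: alpha_values_def)
qed

lemma alpha_eqI:
  assumes "\<alpha> \<in> alternating_bicharacters G" "alpha_values p s \<sigma> i \<alpha>"
  shows "alpha G p s \<sigma> i = \<alpha>"
  unfolding alpha_def using alpha_values_unique assms by (intro the1_equality) auto

lemma alpha_eq_standard: "alpha G p s \<sigma> i = standard_bicharacter"
  by (rule alpha_eqI[OF standard_bicharacter_alternating alpha_values_standard_bicharacter])

end

section \<open>Radicals of the standard bicharacters\<close>

definition radical :: "('a \<times> 'a \<Rightarrow> complex) \<Rightarrow> 'a set" where
  "radical \<alpha> = {g \<in> carrier G. \<forall>h\<in>carrier G. \<alpha> (g, h) = 1}"

text \<open>Each of the first \<open>2 * i\<close> coordinates is detected by the partner of its
  generator: coordinate \<open>j\<close> by \<open>\<sigma> (j + i)\<close> when \<open>j\<close> is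
  at most \<open>i\<close>, and by \<open>\<sigma> (j - i)\<close> otherwise. The converse needs
  only values on generators.\<close>

lemma radical_alpha:
  assumes i: "2 * i \<le> s"
  shows "radical (alpha G p s \<sigma> i) = {g \<in> carrier G. \<forall>j\<in>{1..2 * i}. p dvd coord g j}"
proof -
  let ?\<alpha> = "alpha G p s \<sigma> i"
  have gen: "?\<alpha> (g, \<sigma> l) =
    (if i < l \<and> l \<le> 2 * i then prim_root p ^ coord g (l - i)
     else if l \<le> i then inverse (prim_root p ^ coord g (l + i)) else 1)"
    if "l \<in> {1..s}" "g \<in> carrier G" for g l
    unfolding alpha_eq_standard[OF i] by (rule standard_bicharacter_gen[OF i that])
  note dvd = prim_root_pow_eq_1_iff[OF p_pos]
  have "(\<forall>h\<in>carrier G. ?\<alpha> (g, h) = 1) \<longleftrightarrow> (\<forall>j\<in>{1..2 * i}. p dvd coord g j)" (is "?L \<longleftrightarrow> ?R")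
    if g: "g \<in> carrier G" for g
  proof
    assume L: ?L
    show ?R
    proof
      fix j assume j: "j \<in> {1..2 * i}"
      show "p dvd coord g j"
      proof (cases "j \<le> i")
        case True
        then have "?\<alpha> (g, \<sigma> (j + i)) = prim_root p ^ coord g j"
          using gen[of "j + i" g] g i j by auto
        moreover have "?\<alpha> (g, \<sigma> (j + i)) = 1"
          using L i j True by simp
        ultimately show ?thesis
          by (simp add: dvd)
      next
        case False
        with i j have ji: "j - i \<in> {1..s}" "\<not> i < j - i" "j - i \<le> i" "j - i + i = j"
          by auto
        then have "?\<alpha> (g, \<sigma> (j - i)) = inverse (prim_root p ^ coord g j)"
          using gen[of "j - i" g] g by (simp add: ji)
        moreover have "?\<alpha> (g, \<sigma> (j - i)) = 1"
          using L gen_closed[OF ji(1)] by blast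
        ultimately show ?thesis
          by (metis dvd inverse_eq_1_iff)
      qed
    qed
  next
    assume R: ?R
    have hom: "(\<lambda>h. ?\<alpha> (g, h)) \<in> hom G cplx_mult"
      using g standard_bicharacter_alternating[OF i] unfolding alpha_eq_standard[OF i]
      by (auto simp: alternating_bicharacters_def)
    have triv: "(\<lambda>h. 1) \<in> hom G cplx_mult"
      by (auto simp: hom_def)
    have "?\<alpha> (g, \<sigma> l) = 1" if "l \<in> {1..s}" for l
    proof -
      have "p dvd coord g j" if "1 \<le> j" "j \<le> 2 * i" for j
        using R that by simp
      then show ?thesis
        using that by (auto simp: gen[OF that g] dvd)
    qed
    with hom_eqI[OF comm_group_cplx_mult hom triv] show ?L
      by blast
  qed
  then show ?thesis
    by (auto simp: radical_def)
qed

text \<open>The generator with index \<open>2 * i + 1\<close> separates the two: it is the first one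
  outside the hyperbolic pairs of \<alpha>\<open>\<^sub>i\<close>, and it still belongs to a pair of
  \<alpha>\<open>\<^sub>k\<close>.\<close>

lemma radical_alpha_psubset:
  assumes "i < k" "2 * k \<le> s"
  shows "radical (alpha G p s \<sigma> k) \<subset> radical (alpha G p s \<sigma> i)"
proof -
  have "p dvd coord (\<sigma> (2 * i + 1)) j" if "j \<in> {1..2 * i}" for j
    using assms that coord_gen[of "2 * i + 1" j] by (simp add: dvd_eq_mod_eq_0)
  then have "\<sigma> (2 * i + 1) \<in> radical (alpha G p s \<sigma> i)"
    using assms by (simp add: radical_alpha)
  moreover have "\<not> p dvd coord (\<sigma> (2 * i + 1)) (2 * i + 1)"
    using assms coord_gen[of "2 * i + 1" "2 * i + 1"] by auto
  then have "\<sigma> (2 * i + 1) \<notin> radical (alpha G p s \<sigma> k)"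
    using assms by (auto simp: radical_alpha)
  moreover have "radical (alpha G p s \<sigma> k) \<subseteq> radical (alpha G p s \<sigma> i)"
    using assms by (auto simp: radical_alpha)
  ultimately show ?thesis
    by blast
qed

end

subsection \<open>Symmetric cocycles are coboundaries\<close>

text \<open>A pair \<open>(c, g)\<close> stands for the multiple \<open>c\<close> of the basis
  element at \<open>g\<close> in the twisted group algebra of \<open>q\<close>; this is the group of
  such monomial units. As \<open>q\<close> may be unnormalized, the unit carries the same scalar as
  there.\<close>

definition central_extension ::
    "('a, 'm) monoid_scheme \<Rightarrow> ('a \<times> 'a \<Rightarrow> complex) \<Rightarrow> (complex \<times> 'a) monoid" where
  "central_extension G q =
    \<lparr>carrier = (- {0}) \<times> carrier G,
     monoid.mult = (\<lambda>x y. (fst x * fst y * q (snd x, snd y), snd x \<otimes>\<^bsub>G\<^esub> snd y)),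
     one = (inverse (q (\<one>\<^bsub>G\<^esub>, \<one>\<^bsub>G\<^esub>)), \<one>\<^bsub>G\<^esub>)\<rparr>"

lemma central_extension_simps:
  "carrier (central_extension G q) = (- {0}) \<times> carrier G"
  "x \<otimes>\<^bsub>central_extension G q\<^esub> y = (fst x * fst y * q (snd x, snd y), snd x \<otimes>\<^bsub>G\<^esub> snd y)"
  "\<one>\<^bsub>central_extension G q\<^esub> = (inverse (q (\<one>\<^bsub>G\<^esub>, \<one>\<^bsub>G\<^esub>)), \<one>\<^bsub>G\<^esub>)"
  by (simp_all add: central_extension_def)

lemma comm_group_central_extension:
  assumes "comm_group G" and q: "q \<in> cocycles2 G"
    and sym: "\<And>g h. g \<in> carrier G \<Longrightarrow> h \<in> carrier G \<Longrightarrow> q (g, h) = q (h, g)"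
  shows "comm_group (central_extension G q)"
proof -
  interpret comm_group G by fact
  have nz: "q (g, h) \<noteq> 0" if "g \<in> carrier G" "h \<in> carrier G" for g h
    using q that by (auto simp: cocycles2_def)
  have coc: "q (g, h) * q (g \<otimes>\<^bsub>G\<^esub> h, k) = q (h, k) * q (g, h \<otimes>\<^bsub>G\<^esub> k)"
    if "g \<in> carrier G" "h \<in> carrier G" "k \<in> carrier G" for g h k
    using q that by (auto simp: cocycles2_def)
  note simps = central_extension_simps
  show ?thesis
  proof (rule comm_groupI)
    fix x y assume "x \<in> carrier (central_extension G q)" "y \<in> carrier (central_extension G q)"
    then show "x \<otimes>\<^bsub>central_extension G q\<^esub> y \<in> carrier (central_extension G q)"
      "x \<otimes>\<^bsub>central_extension G q\<^esub> y = y \<otimes>\<^bsub>central_extension G q\<^esub> x"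
      using sym[of "snd x" "snd y"] m_comm[of "snd x" "snd y"] by (auto simp: simps nz)
  next
    fix x y z assume "x \<in> carrier (central_extension G q)" "y \<in> carrier (central_extension G q)"
      "z \<in> carrier (central_extension G q)"
    then show "x \<otimes>\<^bsub>central_extension G q\<^esub> y \<otimes>\<^bsub>central_extension G q\<^esub> z
        = x \<otimes>\<^bsub>central_extension G q\<^esub> (y \<otimes>\<^bsub>central_extension G q\<^esub> z)"
      using coc[of "snd x" "snd y" "snd z"] by (auto simp: simps m_assoc)
  next
    fix x assume x: "x \<in> carrier (central_extension G q)"
    then show "\<one>\<^bsub>central_extension G q\<^esub> \<otimes>\<^bsub>central_extension G q\<^esub> x = x"
      using cocycle_one(1)[OF is_group q, of "snd x"] nz[of "\<one>\<^bsub>G\<^esub>" "\<one>\<^bsub>G\<^esub>"] by (auto simp: simps)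
    define g where "g = snd x"
    have g: "g \<in> carrier G"
      using x by (auto simp: simps g_def)
    \<comment> \<open>The scalar of the inverse solves
      \<open>d * fst x * q (inv g, g) = inverse (q (1, 1))\<close> for \<open>d\<close>.\<close>
    show "\<exists>y\<in>carrier (central_extension G q). y \<otimes>\<^bsub>central_extension G q\<^esub> x = \<one>\<^bsub>central_extension G q\<^esub>"
      using x g nz[of "inv\<^bsub>G\<^esub> g" g] nz[of "\<one>\<^bsub>G\<^esub>" "\<one>\<^bsub>G\<^esub>"]
      by (intro bexI[of _ "(inverse (fst x * q (inv\<^bsub>G\<^esub> g, g) * q (\<one>\<^bsub>G\<^esub>, \<one>\<^bsub>G\<^esub>)), inv\<^bsub>G\<^esub> g)"])
        (auto simp: simps field_simps simp flip: g_def)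
  next
    show "\<one>\<^bsub>central_extension G q\<^esub> \<in> carrier (central_extension G q)"
      using nz[of "\<one>\<^bsub>G\<^esub>" "\<one>\<^bsub>G\<^esub>"] by (simp add: simps)
  qed
qed

lemma snd_central_extension_pow:
  "snd (x [^]\<^bsub>central_extension G q\<^esub> (n::nat)) = snd x [^]\<^bsub>G\<^esub> n"
  by (induction n) (simp_all add: nat_pow_def central_extension_simps)

text \<open>The scalar enters a power only through \<open>c ^ n\<close>, so extracting a root can
  adjust that power at will.\<close>

lemma central_extension_pow:
  "(c, g) [^]\<^bsub>central_extension G q\<^esub> (n::nat) =
    (c ^ n * fst ((1, g) [^]\<^bsub>central_extension G q\<^esub> n), g [^]\<^bsub>G\<^esub> n)"
proof -
  have "fst ((c, g) [^]\<^bsub>central_extension G q\<^esub> n) = c ^ n * fst ((1, g) [^]\<^bsub>central_extension G q\<^esub> n)"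
  proof (induction n)
    case 0
    show ?case
      by (simp add: nat_pow_def)
  next
    case (Suc n)
    have step: "x [^]\<^bsub>central_extension G q\<^esub> Suc n
        = x [^]\<^bsub>central_extension G q\<^esub> n \<otimes>\<^bsub>central_extension G q\<^esub> x" for x
      by (simp add: nat_pow_def)
    show ?case
      by (simp add: step central_extension_simps(2) snd_central_extension_pow Suc)
  qed
  then show ?thesis
    by (simp add: prod_eq_iff snd_central_extension_pow)
qed

context elementary_abelian
begin

text \<open>
  Since roots exist in the complex numbers, the generators lift to elements of order \<open>p\<close> of the
  abelian central extension, so the extension splits.
\<close>

lemma symmetric_cocycle_coboundary:
  assumes q: "q \<in> cocycles2 G"
    and sym: "\<And>g h. g \<in> carrier G \<Longrightarrow> h \<in> carrier G \<Longrightarrow> q (g, h) = q (h, g)"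
  obtains l where "\<And>g. g \<in> carrier G \<Longrightarrow> l g \<noteq> 0"
    "\<And>g h. g \<in> carrier G \<Longrightarrow> h \<in> carrier G \<Longrightarrow> l (g \<otimes> h) = l g * l h * q (g, h)"
proof -
  let ?E = "central_extension G q"
  have E: "comm_group ?E"
    using comm_group_axioms q sym by (rule comm_group_central_extension)
  interpret E: comm_group ?E by (rule E)
  have q1: "q (\<one>, \<one>) \<noteq> 0"
    using cocycle_one(3)[OF is_group q one_closed] .
  have "\<exists>c. c \<noteq> 0 \<and> (c, \<sigma> j) [^]\<^bsub>?E\<^esub> p = \<one>\<^bsub>?E\<^esub>" if j: "j \<in> {1..s}" for j
  proof -
    let ?d = "fst ((1, \<sigma> j) [^]\<^bsub>?E\<^esub> p)"
    have "(1, \<sigma> j) [^]\<^bsub>?E\<^esub> p \<in> carrier ?E"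
      using j by (intro E.nat_pow_closed) (simp add: central_extension_simps)
    then have d: "?d \<noteq> 0"
      by (auto simp: central_extension_simps)
    \<comment> \<open>The target is the scalar of the unit of the extension, which is the inverse of
      \<open>q\<close> at the identity and need not be 1.\<close>
    with q1 obtain c where c: "c ^ p = inverse (q (\<one>, \<one>)) / ?d" "c \<noteq> 0"
      using nth_root_exists[OF p_pos, of "inverse (q (\<one>, \<one>)) / ?d"] by auto
    have "(c, \<sigma> j) [^]\<^bsub>?E\<^esub> p = (c ^ p * ?d, \<sigma> j [^] p)"
      by (rule central_extension_pow)
    also have "\<dots> = \<one>\<^bsub>?E\<^esub>"
      using d j by (simp add: c(1) gen_pow central_extension_simps)
    finally show ?thesis
      using c(2) by blast
  qed
  then obtain c where c: "\<And>j. j \<in> {1..s} \<Longrightarrow> c j \<noteq> 0"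
    "\<And>j. j \<in> {1..s} \<Longrightarrow> (c j, \<sigma> j) [^]\<^bsub>?E\<^esub> p = \<one>\<^bsub>?E\<^esub>"
    by metis
  define v where "v j = (c j, \<sigma> j)" for j
  have v: "v \<in> {1..s} \<rightarrow> carrier ?E"
    using c(1) gen_closed by (auto simp: v_def central_extension_simps simp del: atLeastAtMost_iff)
  have v': "v j [^]\<^bsub>?E\<^esub> p = \<one>\<^bsub>?E\<^esub>" if "j \<in> {1..s}" for j
    unfolding v_def using that by (rule c(2))
  note hom = lift_hom[OF E v v']
  have gen: "lift ?E v (\<sigma> j) = v j" if "j \<in> {1..s}" for j
    using that by (intro lift_gen[OF E v] v')
  \<comment> \<open>The lifted map is a section of the projection: their composite is an
    endomorphism fixing every generator.\<close>
  have snd: "snd (lift ?E v g) = g" if g: "g \<in> carrier G" for g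
  proof (rule hom_eqI[OF comm_group_axioms _ _ g, where h = "\<lambda>g. snd (lift ?E v g)" and h' = "\<lambda>g. g"])
    show "(\<lambda>g. snd (lift ?E v g)) \<in> hom G G"
      using hom by (force simp: hom_def central_extension_simps Pi_iff mem_Times_iff)
    show "(\<lambda>g. g) \<in> hom G G"
      by (simp add: hom_def)
    show "snd (lift ?E v (\<sigma> j)) = \<sigma> j" if "j \<in> {1..s}" for j
      unfolding gen[OF that] by (simp add: v_def)
  qed
  \<comment> \<open>The scalar part of the section trivializes \<open>q\<close>.\<close>
  show ?thesis
  proof
    show "fst (lift ?E v g) \<noteq> 0" if "g \<in> carrier G" for g
      using hom that by (force simp: hom_def central_extension_simps)
    show "fst (lift ?E v (g \<otimes> h)) = fst (lift ?E v g) * fst (lift ?E v h) * q (g, h)"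
      if "g \<in> carrier G" "h \<in> carrier G" for g h
    proof -
      have "lift ?E v (g \<otimes> h) = lift ?E v g \<otimes>\<^bsub>?E\<^esub> lift ?E v h"
        using hom that by (auto simp: hom_def)
      then show ?thesis
        using that by (simp add: central_extension_simps snd)
    qed
  qed
qed

end

subsection \<open>Isometries\<close>

text \<open>The isometry is the monomial map sending the basis element at \<open>g\<close> to
  \<open>l g\<close> times the one at \<open>\<psi> g\<close>. On coefficient functions this pulls
  back along the inverse of \<psi>, and the last hypothesis is its multiplicativity on basis
  elements.\<close>

lemma isometricI:
  assumes "group G" "group H" "finite (carrier G)"
    and f: "f \<in> cocycles2 G" and f': "f' \<in> cocycles2 H" and \<psi>: "\<psi> \<in> iso G H"
    and l: "\<And>g. g \<in> carrier G \<Longrightarrow> l g \<noteq> 0"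
    and lf: "\<And>g h. g \<in> carrier G \<Longrightarrow> h \<in> carrier G \<Longrightarrow>
      f (g, h) * l (g \<otimes>\<^bsub>G\<^esub> h) = l g * l h * f' (\<psi> g, \<psi> h)"
  shows "isometric G f H f'"
proof -
  interpret G: group G by fact
  interpret H: group H by fact
  have bij: "bij_betw \<psi> (carrier G) (carrier H)" and hom: "\<psi> \<in> hom G H"
    using \<psi> by (auto simp: iso_def)
  have finH: "finite (carrier H)"
    using bij assms(3) by (simp add: bij_betw_finite)
  have \<psi>_closed [simp]: "\<psi> g \<in> carrier H" if "g \<in> carrier G" for g
    using hom that by (auto simp: hom_def)
  have \<psi>_mult: "\<psi> (g \<otimes>\<^bsub>G\<^esub> h) = \<psi> g \<otimes>\<^bsub>H\<^esub> \<psi> h" if "g \<in> carrier G" "h \<in> carrier G" for g h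
    using hom that by (auto simp: hom_def)
  have \<psi>_eq: "\<psi> g = \<psi> h \<longleftrightarrow> g = h" if "g \<in> carrier G" "h \<in> carrier G" for g h
    using bij that by (auto simp: bij_betw_def inj_on_def)
  have \<psi>_one: "\<psi> \<one>\<^bsub>G\<^esub> = \<one>\<^bsub>H\<^esub>"
    using hom \<open>group G\<close> \<open>group H\<close> by (rule hom_one)
  have surj: "k \<in> carrier H \<Longrightarrow> \<exists>m\<in>carrier G. k = \<psi> m" for k
    using bij by (auto simp: bij_betw_def)
  let ?A = "twisted_group_algebra G f" and ?B = "twisted_group_algebra H f'"
  define \<psi>' where "\<psi>' = inv_into (carrier G) \<psi>"
  have \<psi>' [simp]: "\<psi>' (\<psi> g) = g" if "g \<in> carrier G" for g
    unfolding \<psi>'_def using bij_betw_inv_into_left[OF bij that] .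
  define \<phi> where "\<phi> x = (\<lambda>k\<in>carrier H. l (\<psi>' k) * x (\<psi>' k))" for x :: "'a \<Rightarrow> complex"
  have \<phi> [simp]: "\<phi> x (\<psi> g) = l g * x g" if "g \<in> carrier G" for x g
    using that by (simp add: \<phi>_def)
  have \<phi>_ext: "\<phi> x \<in> extensional (carrier H)" for x
    by (simp add: \<phi>_def)
  \<comment> \<open>As \<psi> is onto, it suffices to compare values at the points
    \<open>\<psi> m\<close>, where \<phi> has a closed form.\<close>
  have eqI: "\<phi> x = y" if "y \<in> extensional (carrier H)" "\<And>m. m \<in> carrier G \<Longrightarrow> l m * x m = y (\<psi> m)" for x y
    using \<phi>_ext that(1)
  proof (rule extensionalityI)
    fix k assume "k \<in> carrier H"
    then obtain m where "m \<in> carrier G" "k = \<psi> m"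
      using surj by blast
    with that(2) show "\<phi> x k = y k" by simp
  qed
  have "\<phi> \<in> isometries G f H f'"
    unfolding isometries_def
  proof (intro CollectI conjI ballI allI ring_hom_memI)
    fix x y assume "x \<in> carrier ?A" "y \<in> carrier ?A"
    show "\<phi> (x \<oplus>\<^bsub>?A\<^esub> y) = \<phi> x \<oplus>\<^bsub>?B\<^esub> \<phi> y"
      by (rule eqI) (simp_all add: tga_simps distrib_left)
    show "\<phi> (x \<otimes>\<^bsub>?A\<^esub> y) = \<phi> x \<otimes>\<^bsub>?B\<^esub> \<phi> y"
    proof (rule eqI)
      fix m assume m: "m \<in> carrier G"
      have "l m * (x \<otimes>\<^bsub>?A\<^esub> y) m = (\<Sum>g\<in>carrier G. \<Sum>h\<in>carrier G.
          if g \<otimes>\<^bsub>G\<^esub> h = m then x g * y h * (f (g, h) * l (g \<otimes>\<^bsub>G\<^esub> h)) else 0)"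
        using m by (auto simp: tga_mult[OF assms(3)] sum_distrib_left intro!: sum.cong)
      also have "\<dots> = (\<Sum>g\<in>carrier G. \<Sum>h\<in>carrier G.
          if \<psi> g \<otimes>\<^bsub>H\<^esub> \<psi> h = \<psi> m then \<phi> x (\<psi> g) * \<phi> y (\<psi> h) * f' (\<psi> g, \<psi> h) else 0)"
      proof (intro sum.cong refl)
        fix g h assume gh: "g \<in> carrier G" "h \<in> carrier G"
        have "\<psi> g \<otimes>\<^bsub>H\<^esub> \<psi> h = \<psi> m \<longleftrightarrow> g \<otimes>\<^bsub>G\<^esub> h = m"
          using gh m by (simp add: \<psi>_eq flip: \<psi>_mult)
        then show "(if g \<otimes>\<^bsub>G\<^esub> h = m then x g * y h * (f (g, h) * l (g \<otimes>\<^bsub>G\<^esub> h)) else 0)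
          = (if \<psi> g \<otimes>\<^bsub>H\<^esub> \<psi> h = \<psi> m then \<phi> x (\<psi> g) * \<phi> y (\<psi> h) * f' (\<psi> g, \<psi> h) else 0)"
          unfolding lf[OF gh] using gh by simp
      qed
      also have "\<dots> = (\<Sum>g\<in>carrier G. \<Sum>b\<in>carrier H.
          if \<psi> g \<otimes>\<^bsub>H\<^esub> b = \<psi> m then \<phi> x (\<psi> g) * \<phi> y b * f' (\<psi> g, b) else 0)"
        by (intro sum.cong refl sum.reindex_bij_betw[OF bij])
      also have "\<dots> = (\<Sum>a\<in>carrier H. \<Sum>b\<in>carrier H.
          if a \<otimes>\<^bsub>H\<^esub> b = \<psi> m then \<phi> x a * \<phi> y b * f' (a, b) else 0)"
        by (rule sum.reindex_bij_betw[OF bij])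
      also have "\<dots> = (\<phi> x \<otimes>\<^bsub>?B\<^esub> \<phi> y) (\<psi> m)"
        using m by (simp add: tga_mult[OF finH])
      finally show "l m * (x \<otimes>\<^bsub>?A\<^esub> y) m = (\<phi> x \<otimes>\<^bsub>?B\<^esub> \<phi> y) (\<psi> m)" .
    qed (simp add: tga_mult[OF finH])
  next
    have "f (\<one>\<^bsub>G\<^esub>, \<one>\<^bsub>G\<^esub>) * l \<one>\<^bsub>G\<^esub> = l \<one>\<^bsub>G\<^esub> * l \<one>\<^bsub>G\<^esub> * f' (\<one>\<^bsub>H\<^esub>, \<one>\<^bsub>H\<^esub>)"
      using lf[of "\<one>\<^bsub>G\<^esub>" "\<one>\<^bsub>G\<^esub>"] by (simp add: \<psi>_one)
    then have l1: "l \<one>\<^bsub>G\<^esub> * inverse (f (\<one>\<^bsub>G\<^esub>, \<one>\<^bsub>G\<^esub>)) = inverse (f' (\<one>\<^bsub>H\<^esub>, \<one>\<^bsub>H\<^esub>))"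
      using l[of "\<one>\<^bsub>G\<^esub>"] cocycle_one(3)[OF \<open>group G\<close> f G.one_closed] cocycle_one(3)[OF \<open>group H\<close> f' H.one_closed]
      by (simp add: field_simps)
    show "\<phi> \<one>\<^bsub>?A\<^esub> = \<one>\<^bsub>?B\<^esub>"
      by (rule eqI) (auto simp: tga_one l1 \<psi>_eq simp flip: \<psi>_one)
  next
    show "bij_betw \<phi> (carrier ?A) (carrier ?B)"
    proof (rule bij_betw_byWitness[where f' = "\<lambda>y. \<lambda>m\<in>carrier G. y (\<psi> m) / l m"])
      show "\<forall>x\<in>carrier ?A. (\<lambda>m\<in>carrier G. \<phi> x (\<psi> m) / l m) = x"
        using l by (auto simp: tga_simps PiE_iff intro!: extensionalityI)
      show "\<forall>y\<in>carrier ?B. \<phi> (\<lambda>m\<in>carrier G. y (\<psi> m) / l m) = y"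
        using l by (auto simp: tga_simps PiE_iff intro!: eqI)
    qed (auto simp: tga_simps \<phi>_def)
  next
    fix c x
    show "\<phi> (c \<odot>\<^bsub>?A\<^esub> x) = c \<odot>\<^bsub>?B\<^esub> \<phi> x"
      by (rule eqI) (simp_all add: tga_simps)
    have "{k \<in> carrier H. \<phi> x k \<noteq> 0} = \<psi> ` {g \<in> carrier G. x g \<noteq> 0}"
      using l surj by fastforce
    moreover have "inj_on \<psi> {g \<in> carrier G. x g \<noteq> 0}"
      using \<psi>_eq by (auto simp: inj_on_def)
    ultimately show "hamming_weight H (\<phi> x) = hamming_weight G x"
      by (simp add: hamming_weight_def card_image)
  qed (auto simp: tga_simps \<phi>_def)
  then show ?thesis
    by (auto simp: isometric_def)
qed

text \<open>The vectors of weight one are the nonzero multiples of basis elements, so preservation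
  of weights forces the monomial form.\<close>

lemma isometricD:
  fixes G (structure)
  assumes "group G" and fin: "finite (carrier G)"
    and f: "f \<in> cocycles2 G" and f': "f' \<in> cocycles2 G" and "isometric G f G f'"
  obtains \<psi> l where "\<psi> \<in> iso G G" "\<And>g. g \<in> carrier G \<Longrightarrow> l g \<noteq> 0"
    "\<And>g h. g \<in> carrier G \<Longrightarrow> h \<in> carrier G \<Longrightarrow>
      f (g, h) * l (g \<otimes> h) = l g * l h * f' (\<psi> g, \<psi> h)"
proof -
  interpret group G by fact
  let ?A = "twisted_group_algebra G f" and ?B = "twisted_group_algebra G f'"
  obtain \<phi> where hom: "\<phi> \<in> ring_hom ?A ?B" and bij: "bij_betw \<phi> (carrier ?A) (carrier ?B)"
    and smult: "\<And>c x. x \<in> carrier ?A \<Longrightarrow> \<phi> (c \<odot>\<^bsub>?A\<^esub> x) = c \<odot>\<^bsub>?B\<^esub> \<phi> x"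
    and weight: "\<And>x. x \<in> carrier ?A \<Longrightarrow> hamming_weight G (\<phi> x) = hamming_weight G x"
    using assms(5) by (auto simp: isometric_def isometries_def)
  have nz': "f' (g, h) \<noteq> 0" if "g \<in> carrier G" "h \<in> carrier G" for g h
    using f' that by (auto simp: cocycles2_def)
  let ?u = "basis_elt G"
  have u: "?u g \<in> carrier ?A" for g
    by (simp add: basis_elt_def tga_simps)
  have "\<exists>k c. k \<in> carrier G \<and> c \<noteq> 0 \<and> \<phi> (?u g) = c \<odot>\<^bsub>?B\<^esub> ?u k" if g: "g \<in> carrier G" for g
  proof -
    have "{k \<in> carrier G. ?u g k \<noteq> 0} = {g}"
      using g by (auto simp: basis_elt_def)
    then have "card {k \<in> carrier G. \<phi> (?u g) k \<noteq> 0} = 1"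
      using weight[OF u, of g] by (simp add: hamming_weight_def)
    then obtain k where k: "{k \<in> carrier G. \<phi> (?u g) k \<noteq> 0} = {k}"
      by (rule card_1_singletonE)
    have "\<phi> (?u g) \<in> carrier ?B"
      using bij u by (rule bij_betw_apply)
    then have ext: "\<phi> (?u g) \<in> extensional (carrier G)"
      by (simp add: tga_simps PiE_def)
    have "\<phi> (?u g) = \<phi> (?u g) k \<odot>\<^bsub>?B\<^esub> ?u k"
      using ext by (rule extensionalityI) (use k in \<open>auto simp: tga_simps basis_elt_def\<close>)
    with k show ?thesis
      by blast
  qed
  then obtain \<psi> l where \<psi>: "\<And>g. g \<in> carrier G \<Longrightarrow> \<psi> g \<in> carrier G"
    and l: "\<And>g. g \<in> carrier G \<Longrightarrow> l g \<noteq> 0"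
    and \<phi>: "\<And>g. g \<in> carrier G \<Longrightarrow> \<phi> (?u g) = l g \<odot>\<^bsub>?B\<^esub> ?u (\<psi> g)"
    by metis
  have key: "\<psi> (g \<otimes> h) = \<psi> g \<otimes> \<psi> h \<and> f (g, h) * l (g \<otimes> h) = l g * l h * f' (\<psi> g, \<psi> h)"
    if g: "g \<in> carrier G" and h: "h \<in> carrier G" for g h
  proof -
    have "f (g, h) \<odot>\<^bsub>?B\<^esub> (l (g \<otimes> h) \<odot>\<^bsub>?B\<^esub> ?u (\<psi> (g \<otimes> h))) = \<phi> (f (g, h) \<odot>\<^bsub>?A\<^esub> ?u (g \<otimes> h))"
      using g h by (simp add: smult u \<phi>)
    also have "\<dots> = \<phi> (?u g \<otimes>\<^bsub>?A\<^esub> ?u h)"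
      using g h by (simp add: basis_elt_mult[OF assms(1) fin])
    also have "\<dots> = \<phi> (?u g) \<otimes>\<^bsub>?B\<^esub> \<phi> (?u h)"
      using hom u u by (rule ring_hom_mult)
    also have "\<dots> = l h \<odot>\<^bsub>?B\<^esub> (l g \<odot>\<^bsub>?B\<^esub> (f' (\<psi> g, \<psi> h) \<odot>\<^bsub>?B\<^esub> ?u (\<psi> g \<otimes> \<psi> h)))"
      using g h \<psi> by (simp add: \<phi> tga_smult_mult[OF fin] basis_elt_mult[OF assms(1) fin])
    \<comment> \<open>At this point the right side is nonzero. Hence so is the left side, which puts
      the point at \<open>\<psi> (g \<otimes> h)\<close>; the same evaluation yields the scalar
      identity.\<close>
    finally have "(f (g, h) \<odot>\<^bsub>?B\<^esub> (l (g \<otimes> h) \<odot>\<^bsub>?B\<^esub> ?u (\<psi> (g \<otimes> h)))) (\<psi> g \<otimes> \<psi> h) =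
        (l h \<odot>\<^bsub>?B\<^esub> (l g \<odot>\<^bsub>?B\<^esub> (f' (\<psi> g, \<psi> h) \<odot>\<^bsub>?B\<^esub> ?u (\<psi> g \<otimes> \<psi> h)))) (\<psi> g \<otimes> \<psi> h)"
      by simp
    then have "f (g, h) * (l (g \<otimes> h) * (if \<psi> g \<otimes> \<psi> h = \<psi> (g \<otimes> h) then 1 else 0)) =
        l h * (l g * f' (\<psi> g, \<psi> h))"
      using g h \<psi> by (simp add: tga_simps basis_elt_def)
    then show ?thesis
      using l[OF g] l[OF h] nz' \<psi> g h by (auto split: if_splits)
  qed
  have "inj_on \<psi> (carrier G)"
  proof (rule inj_onI)
    fix g h assume gh: "g \<in> carrier G" "h \<in> carrier G" "\<psi> g = \<psi> h"
    \<comment> \<open>If two basis elements went to proportional vectors, rescaling them crosswise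
      would give equal images, hence equal vectors, although their supports differ unless
      \<open>g = h\<close>.\<close>
    have "\<phi> (l h \<odot>\<^bsub>?A\<^esub> ?u g) = l h \<odot>\<^bsub>?B\<^esub> (l g \<odot>\<^bsub>?B\<^esub> ?u (\<psi> g))"
      by (simp only: smult[OF u] \<phi>[OF gh(1)])
    also have "\<dots> = l g \<odot>\<^bsub>?B\<^esub> (l h \<odot>\<^bsub>?B\<^esub> ?u (\<psi> h))"
      by (auto simp: tga_simps gh(3) intro!: restrict_ext)
    also have "\<dots> = \<phi> (l g \<odot>\<^bsub>?A\<^esub> ?u h)"
      by (simp only: smult[OF u] \<phi>[OF gh(2)])
    finally have "\<phi> (l h \<odot>\<^bsub>?A\<^esub> ?u g) = \<phi> (l g \<odot>\<^bsub>?A\<^esub> ?u h)" .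
    then have "l h \<odot>\<^bsub>?A\<^esub> ?u g = l g \<odot>\<^bsub>?A\<^esub> ?u h"
      by (rule inj_onD[OF bij_betw_imp_inj_on[OF bij]]) (auto simp: tga_simps)
    then have "(l h \<odot>\<^bsub>?A\<^esub> ?u g) g = (l g \<odot>\<^bsub>?A\<^esub> ?u h) g"
      by simp
    then show "g = h"
      using gh l by (auto simp: tga_simps basis_elt_def split: if_splits)
  qed
  moreover from this have "\<psi> ` carrier G = carrier G"
    using \<psi> by (intro endo_inj_surj fin) auto
  ultimately have "\<psi> \<in> iso G G"
    using key \<psi> by (auto simp: iso_def hom_def bij_betw_def)
  then show ?thesis
    using l key by (intro that[of \<psi> l]) auto
qed

section \<open>From isometries to equivalence of bicharacters\<close>

context elementary_abelian
begin

lemma isometric_iff_bicharacter: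
  assumes f: "f \<in> cocycles2 G" and f': "f' \<in> cocycles2 G"
  shows "isometric G f G f' \<longleftrightarrow> (\<exists>\<psi>\<in>iso G G. \<forall>g\<in>carrier G. \<forall>h\<in>carrier G.
    cocycle_bicharacter G f (g, h) = cocycle_bicharacter G f' (\<psi> g, \<psi> h))"
    (is "?L \<longleftrightarrow> ?R")
proof
  have nz: "f (g, h) \<noteq> 0" "f' (g, h) \<noteq> 0" if "g \<in> carrier G" "h \<in> carrier G" for g h
    using f f' that by (auto simp: cocycles2_def)
  have iso_closed: "\<psi> g \<in> carrier G" if "\<psi> \<in> iso G G" "g \<in> carrier G" for \<psi> g
    using that by (auto simp: iso_def hom_def)
  {
    assume ?L
    then obtain \<psi> l where \<psi>: "\<psi> \<in> iso G G" and l: "\<And>g. g \<in> carrier G \<Longrightarrow> l g \<noteq> 0"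
      and lf: "\<And>g h. g \<in> carrier G \<Longrightarrow> h \<in> carrier G \<Longrightarrow>
        f (g, h) * l (g \<otimes> h) = l g * l h * f' (\<psi> g, \<psi> h)"
      using isometricD[OF is_group finite_carrier f f'] by blast
    have "f (g, h) / f (h, g) = f' (\<psi> g, \<psi> h) / f' (\<psi> h, \<psi> g)"
      if "g \<in> carrier G" "h \<in> carrier G" for g h
    proof -
      have eq: "f (g, h) = l g * l h * f' (\<psi> g, \<psi> h) / l (g \<otimes> h)"
        if "g \<in> carrier G" "h \<in> carrier G" for g h
        using lf[OF that] l that by (simp add: field_simps)
      show ?thesis
        unfolding eq[OF that] eq[OF that(2,1)] m_comm[OF that(2,1)] using l that by simp
    qed
    then show ?R
      using \<psi> iso_closed by (intro bexI[OF _ \<psi>]) (auto simp: cocycle_bicharacter_def divide_inverse)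
  }
  assume ?R
  then obtain \<psi> where \<psi>: "\<psi> \<in> iso G G" and eq: "\<And>g h. g \<in> carrier G \<Longrightarrow> h \<in> carrier G \<Longrightarrow>
      cocycle_bicharacter G f (g, h) = cocycle_bicharacter G f' (\<psi> g, \<psi> h)"
    by blast
  have \<psi>_mult: "\<psi> (g \<otimes> h) = \<psi> g \<otimes> \<psi> h" if "g \<in> carrier G" "h \<in> carrier G" for g h
    using \<psi> that by (auto simp: iso_def hom_def)
  \<comment> \<open>Chosen so that a trivialization \<open>l\<close> of \<open>q\<close> satisfies
    exactly the identity that \<open>isometricI\<close> demands; equality of the bicharacters is the
    symmetry of \<open>q\<close>.\<close>
  define q where "q = (\<lambda>(g, h)\<in>carrier G \<times> carrier G. f' (\<psi> g, \<psi> h) / f (g, h))"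
  have q: "q (g, h) = f' (\<psi> g, \<psi> h) / f (g, h)" if "g \<in> carrier G" "h \<in> carrier G" for g h
    using that by (simp add: q_def)
  have "q (g, h) * q (g \<otimes> h, k) = q (h, k) * q (g, h \<otimes> k)"
    if "g \<in> carrier G" "h \<in> carrier G" "k \<in> carrier G" for g h k
  proof -
    have "f (g, h) * f (g \<otimes> h, k) = f (h, k) * f (g, h \<otimes> k)"
      "f' (\<psi> g, \<psi> h) * f' (\<psi> g \<otimes> \<psi> h, \<psi> k) = f' (\<psi> h, \<psi> k) * f' (\<psi> g, \<psi> h \<otimes> \<psi> k)"
      using f f' that iso_closed[OF \<psi>] by (auto simp: cocycles2_def)
    then show ?thesis
      using that by (simp add: q \<psi>_mult)
  qed
  moreover have "q \<in> extensional (carrier G \<times> carrier G)"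
    by (simp add: q_def)
  ultimately have q_cocycle: "q \<in> cocycles2 G"
    using nz iso_closed[OF \<psi>] by (auto simp: cocycles2_def PiE_def q)
  have q_sym: "q (g, h) = q (h, g)" if "g \<in> carrier G" "h \<in> carrier G" for g h
    using eq[OF that] nz iso_closed[OF \<psi>] that
    by (simp add: cocycle_bicharacter_def q field_simps)
  obtain l where l: "\<And>g. g \<in> carrier G \<Longrightarrow> l g \<noteq> 0"
    "\<And>g h. g \<in> carrier G \<Longrightarrow> h \<in> carrier G \<Longrightarrow> l (g \<otimes> h) = l g * l h * q (g, h)"
    using symmetric_cocycle_coboundary[OF q_cocycle q_sym] by blast
  show ?L
    using is_group is_group finite_carrier f f' \<psi> l(1)
  proof (rule isometricI)
    fix g h assume "g \<in> carrier G" "h \<in> carrier G"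
    then show "f (g, h) * l (g \<otimes> h) = l g * l h * f' (\<psi> g, \<psi> h)"
      using nz by (simp add: l(2) q)
  qed
qed

text \<open>The automorphism that matches the bicharacters maps one radical onto the other.
  Surjectivity matters, because membership in a radical tests against all elements.\<close>

lemma isometric_card_radical:
  assumes "f \<in> cocycles2 G" "f' \<in> cocycles2 G" "isometric G f G f'"
  shows "card (radical (cocycle_bicharacter G f)) = card (radical (cocycle_bicharacter G f'))"
proof -
  obtain \<psi> where \<psi>: "\<psi> \<in> iso G G" and eq: "\<And>g h. g \<in> carrier G \<Longrightarrow> h \<in> carrier G \<Longrightarrow>
      cocycle_bicharacter G f (g, h) = cocycle_bicharacter G f' (\<psi> g, \<psi> h)"
    using assms isometric_iff_bicharacter by blast
  have inj: "inj_on \<psi> (carrier G)" and im: "\<psi> ` carrier G = carrier G"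
    using \<psi> by (auto simp: iso_def bij_betw_def)
  have "\<psi> ` radical (cocycle_bicharacter G f) = radical (cocycle_bicharacter G f')"
  proof (intro equalityI subsetI)
    fix k assume "k \<in> \<psi> ` radical (cocycle_bicharacter G f)"
    then obtain g where g: "g \<in> radical (cocycle_bicharacter G f)" "k = \<psi> g"
      by blast
    have "cocycle_bicharacter G f' (k, m) = 1" if m: "m \<in> carrier G" for m
    proof -
      obtain h where "h \<in> carrier G" "m = \<psi> h"
        using m im by blast
      then show ?thesis
        using g eq[of g h] by (simp add: radical_def)
    qed
    moreover have "k \<in> carrier G"
      using g im by (auto simp: radical_def)
    ultimately show "k \<in> radical (cocycle_bicharacter G f')"
      by (simp add: radical_def)
  next
    fix k assume k: "k \<in> radical (cocycle_bicharacter G f')"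
    then have "k \<in> carrier G"
      by (simp add: radical_def)
    then obtain g where g: "g \<in> carrier G" "k = \<psi> g"
      using im by blast
    have "cocycle_bicharacter G f (g, h) = 1" if "h \<in> carrier G" for h
    proof -
      have "\<psi> h \<in> carrier G"
        using im that by blast
      then show ?thesis
        using eq[OF g(1) that] k g(2) by (simp add: radical_def)
    qed
    with g show "k \<in> \<psi> ` radical (cocycle_bicharacter G f)"
      by (auto simp: radical_def)
  qed
  moreover have "inj_on \<psi> (radical (cocycle_bicharacter G f))"
    using inj by (rule inj_on_subset) (auto simp: radical_def)
  ultimately show ?thesis
    by (metis card_image)
qed

text \<open>Both radicals have the size of the radical belonging to \<open>f\<close>, and finite
  sets of equal size cannot be strictly nested.\<close>

lemma isometric_alpha_unique:
  assumes F: "\<And>i. i \<le> s div 2 \<Longrightarrow> F i \<in> cocycles2 G \<and> cocycle_bicharacter G (F i) = alpha G p s \<sigma> i"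
    and f: "f \<in> cocycles2 G" and i: "i \<le> s div 2" "isometric G f G (F i)"
    and k: "k \<le> s div 2" "isometric G f G (F k)"
  shows "i = k"
proof -
  have card: "card (radical (alpha G p s \<sigma> i)) = card (radical (alpha G p s \<sigma> k))"
    using isometric_card_radical[OF f _ i(2)] isometric_card_radical[OF f _ k(2)] F[OF i(1)] F[OF k(1)]
    by simp
  have less: "card (radical (alpha G p s \<sigma> n)) < card (radical (alpha G p s \<sigma> m))" if "m < n" "n \<le> s div 2" for m n
  proof (rule psubset_card_mono)
    show "finite (radical (alpha G p s \<sigma> m))"
      using finite_carrier by (simp add: radical_def)
    show "radical (alpha G p s \<sigma> n) \<subset> radical (alpha G p s \<sigma> m)"
      using that by (intro radical_alpha_psubset) auto
  qed
  show ?thesis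
    using card less[of i k] less[of k i] i(1) k(1) by (cases i k rule: linorder_cases) auto
qed

section \<open>Normal form of an alternating bicharacter\<close>

lemma symplectic_basis:
  assumes \<beta>: "\<beta> \<in> alternating_bicharacters G"
  obtains n \<tau> where "2 * n \<le> s" "\<tau> \<in> {1..s} \<rightarrow> carrier G" "carrier G \<subseteq> generate G (\<tau> ` {1..s})"
    "\<And>j l. j \<in> {1..s} \<Longrightarrow> l \<in> {1..s} \<Longrightarrow> j < l \<Longrightarrow>
      \<beta> (\<tau> j, \<tau> l) = (if 1 \<le> j \<and> j \<le> n \<and> l = j + n then prim_root p else 1)"
proof -
  interpret alternating_bicharacter G \<beta> by unfold_locales fact
  have gens: "finite (\<sigma> ` {1..s})" "\<sigma> ` {1..s} \<subseteq> carrier G"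
    by auto
  obtain n a b C where C: "finite C" "2 * n + card C \<le> card (\<sigma> ` {1..s})"
    and sub: "a ` {..<n} \<union> b ` {..<n} \<union> C \<subseteq> generate G (\<sigma> ` {1..s})"
    and gen: "\<sigma> ` {1..s} \<subseteq> generate G (a ` {..<n} \<union> b ` {..<n} \<union> C)"
    and symp: "symplectic p n a b C"
    using symplectic_generators[OF p_prime exponent gens] by blast
  have "card (\<sigma> ` {1..s}) \<le> s"
    using card_image_le[of "{1..s}" \<sigma>] by simp
  with C have s: "2 * n + card C \<le> s"
    by linarith
  let ?T = "a ` {..<n} \<union> b ` {..<n} \<union> C"
  have T: "?T \<subseteq> carrier G"
    using sub generate_gens by simp
  have "generate G (\<sigma> ` {1..s}) \<subseteq> generate G ?T"
    using gen T by (intro generate_subgroup_incl generate_is_subgroup)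
  then have carrier: "carrier G \<subseteq> generate G ?T"
    by (simp only: generate_gens)
  obtain c where "bij_betw c {0..<card C} C"
    using ex_bij_betw_nat_finite[OF C(1)] by blast
  then have c: "c ` {..<card C} = C"
    by (simp add: bij_betw_def atLeast0LessThan)
  \<comment> \<open>Blocks in the order \<open>a\<close>, \<open>b\<close>, \<open>C\<close> put the
    two members of a pair exactly \<open>n\<close> positions apart, as in
    \<alpha>\<open>\<^sub>n\<close>. Positions start at 1 and the families at 0, hence the shifts;
    the identity pads the list to length \<open>s\<close>.\<close>
  define \<tau> where "\<tau> j = (if j \<le> n then a (j - 1) else if j \<le> 2 * n then b (j - n - 1)
    else if j \<le> 2 * n + card C then c (j - 2 * n - 1) else \<one>)" for j
  have "a i \<in> \<tau> ` {1..s}" if "i < n" for i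
    using that s by (intro image_eqI[of _ _ "i + 1"]) (simp_all add: \<tau>_def)
  moreover have "b i \<in> \<tau> ` {1..s}" if "i < n" for i
    using that s by (intro image_eqI[of _ _ "n + i + 1"]) (simp_all add: \<tau>_def)
  moreover have "c i \<in> \<tau> ` {1..s}" if "i < card C" for i
    using that s by (intro image_eqI[of _ _ "2 * n + i + 1"]) (simp_all add: \<tau>_def)
  moreover have "\<exists>i<card C. x = c i" if "x \<in> C" for x
    using that c by blast
  ultimately have T_sub: "?T \<subseteq> \<tau> ` {1..s}"
    by blast
  have ab: "a i \<in> carrier G" "b i \<in> carrier G" if "i < n" for i
    using T that by auto
  have c_mem: "c i \<in> C" if "i < card C" for i
    using c that by blast
  have C_carrier: "x \<in> carrier G" if "x \<in> C" for x
    using T that by auto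
  \<comment> \<open>The padding is counted with \<open>C\<close>, because the identity is orthogonal
    to everything too.\<close>
  have cases: "(\<exists>i<n. j = i + 1 \<and> \<tau> j = a i) \<or> (\<exists>i<n. j = n + i + 1 \<and> \<tau> j = b i) \<or>
      2 * n < j \<and> \<tau> j \<in> insert \<one> C" if "j \<in> {1..s}" for j
  proof -
    consider "j \<le> n" | "n < j" "j \<le> 2 * n" | "2 * n < j" "j \<le> 2 * n + card C" | "2 * n + card C < j"
      by linarith
    then show ?thesis
    proof cases
      case 1
      with that have "j - 1 < n \<and> j = (j - 1) + 1 \<and> \<tau> j = a (j - 1)"
        by (auto simp: \<tau>_def)
      then show ?thesis by blast
    next
      case 2
      then have "j - n - 1 < n \<and> j = n + (j - n - 1) + 1 \<and> \<tau> j = b (j - n - 1)"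
        by (auto simp: \<tau>_def)
      then show ?thesis by blast
    next
      case 3
      then have "\<tau> j \<in> C"
        using c_mem[of "j - 2 * n - 1"] by (auto simp: \<tau>_def)
      with 3 show ?thesis by blast
    qed (auto simp: \<tau>_def)
  qed
  show ?thesis
  proof
    show "2 * n \<le> s"
      using s by simp
    show "\<tau> \<in> {1..s} \<rightarrow> carrier G"
    proof (rule funcsetI)
      fix j assume "j \<in> {1..s}"
      from cases[OF this] show "\<tau> j \<in> carrier G"
        using ab C_carrier by (elim disjE exE conjE) auto
    qed
    show "carrier G \<subseteq> generate G (\<tau> ` {1..s})"
      using carrier mono_generate[OF T_sub] by blast
    fix j l assume jl: "j \<in> {1..s}" "l \<in> {1..s}" "j < l"
    have a: "\<beta> (a i, x) = 1" and b: "\<beta> (b i, x) = 1" if "i < n" "x \<in> insert \<one> C" for i x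
      using symp that ab[OF that(1)] by (auto simp: symplectic_def)
    have cc: "\<beta> (x, y) = 1" if "x \<in> insert \<one> C" "y \<in> insert \<one> C" for x y
      using symp that C_carrier by (auto simp: symplectic_def)
    have sympD: "\<beta> (a i, a k) = 1" "\<beta> (b i, b k) = 1" "\<beta> (a i, b k) = (if i = k then prim_root p else 1)"
      if "i < n" "k < n" for i k
      using symp that by (simp_all add: symplectic_def)
    \<comment> \<open>For positions \<open>j = i + 1\<close> and \<open>l = n + k + 1\<close> the
      condition \<open>l = j + n\<close> says \<open>i = k\<close>. The assumption
      \<open>j < l\<close> excludes a member of \<open>b\<close> in front of a member of
      \<open>a\<close>.\<close>
    show "\<beta> (\<tau> j, \<tau> l) = (if 1 \<le> j \<and> j \<le> n \<and> l = j + n then prim_root p else 1)"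
      using cases[OF jl(1)]
    proof (elim disjE exE conjE)
      fix i assume i: "i < n" "j = i + 1" "\<tau> j = a i"
      show ?thesis
        using cases[OF jl(2)] i a by (elim disjE exE conjE) (auto simp: sympD)
    next
      fix i assume i: "i < n" "j = n + i + 1" "\<tau> j = b i"
      show ?thesis
        using cases[OF jl(2)] i b jl(3) by (elim disjE exE conjE) (auto simp: sympD)
    next
      assume j: "2 * n < j" "\<tau> j \<in> insert \<one> C"
      then have "\<tau> l \<in> insert \<one> C"
        using cases[OF jl(2)] jl(3) by auto
      with j show ?thesis
        using cc by auto
    qed
  qed
qed

text \<open>Pulling \<beta> back along the automorphism that moves the generators to the symplectic
  family gives a bicharacter with the defining values of \<alpha>\<open>\<^sub>n\<close>, and these
  values determine it.\<close>

lemma bicharacter_equivalent_alpha: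
  assumes \<beta>: "\<beta> \<in> alternating_bicharacters G"
  obtains n \<psi> where "n \<le> s div 2" "\<psi> \<in> iso G G"
    "\<And>g h. g \<in> carrier G \<Longrightarrow> h \<in> carrier G \<Longrightarrow> alpha G p s \<sigma> n (g, h) = \<beta> (\<psi> g, \<psi> h)"
proof -
  interpret alternating_bicharacter G \<beta> by unfold_locales fact
  obtain n \<tau> where n: "2 * n \<le> s" and \<tau>: "\<tau> \<in> {1..s} \<rightarrow> carrier G"
    and gen: "carrier G \<subseteq> generate G (\<tau> ` {1..s})"
    and val: "\<And>j l. j \<in> {1..s} \<Longrightarrow> l \<in> {1..s} \<Longrightarrow> j < l \<Longrightarrow>
      \<beta> (\<tau> j, \<tau> l) = (if 1 \<le> j \<and> j \<le> n \<and> l = j + n then prim_root p else 1)"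
    using symplectic_basis[OF \<beta>] by blast
  define \<psi> where "\<psi> = lift G \<tau>"
  have \<psi>: "\<psi> \<in> iso G G"
    unfolding \<psi>_def using \<tau> gen by (rule lift_iso)
  have \<psi>_closed: "\<psi> g \<in> carrier G" if "g \<in> carrier G" for g
    using \<psi> that by (auto simp: iso_def hom_def)
  have \<psi>_mult: "\<psi> (g \<otimes> h) = \<psi> g \<otimes> \<psi> h" if "g \<in> carrier G" "h \<in> carrier G" for g h
    using \<psi> that by (auto simp: iso_def hom_def)
  have \<psi>_gen: "\<psi> (\<sigma> j) = \<tau> j" if "j \<in> {1..s}" for j
    unfolding \<psi>_def using that \<tau>
    by (intro lift_gen[OF comm_group_axioms \<tau>] exponent) (auto simp del: atLeastAtMost_iff)
  define \<gamma> where "\<gamma> = (\<lambda>(g, h)\<in>carrier G \<times> carrier G. \<beta> (\<psi> g, \<psi> h))"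
  have \<gamma>: "\<gamma> (g, h) = \<beta> (\<psi> g, \<psi> h)" if "g \<in> carrier G" "h \<in> carrier G" for g h
    using that by (simp add: \<gamma>_def)
  have "\<gamma> \<in> extensional (carrier G \<times> carrier G)"
    by (simp add: \<gamma>_def)
  then have alt: "\<gamma> \<in> alternating_bicharacters G"
    by (auto simp: alternating_bicharacters_def hom_def \<gamma> \<psi>_closed \<psi>_mult nonzero mult_left mult_right self)
  have "\<gamma> (\<sigma> j, \<sigma> l) = (if 1 \<le> j \<and> j \<le> n \<and> l = j + n then prim_root p else 1)"
    if "j \<in> {1..s}" "l \<in> {1..s}" "j < l" for j l
    using val[OF that] \<gamma>[OF gen_closed[OF that(1)] gen_closed[OF that(2)]] \<psi>_gen[OF that(1)] \<psi>_gen[OF that(2)]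
    by simp
  then have "alpha_values p s \<sigma> n \<gamma>"
    unfolding alpha_values_def prim_root_def[symmetric] by blast
  then have "alpha G p s \<sigma> n = \<gamma>"
    using n alt by (intro alpha_eqI)
  with n \<psi> \<gamma> show ?thesis
    by (intro that[of n \<psi>]) auto
qed

lemma isometric_alpha_exists:
  assumes F: "\<And>i. i \<le> s div 2 \<Longrightarrow> F i \<in> cocycles2 G \<and> cocycle_bicharacter G (F i) = alpha G p s \<sigma> i"
    and f: "f \<in> cocycles2 G"
  obtains i where "i \<le> s div 2" "isometric G f G (F i)"
proof -
  obtain n \<psi> where n: "n \<le> s div 2" and \<psi>: "\<psi> \<in> iso G G"
    and eq: "\<And>g h. g \<in> carrier G \<Longrightarrow> h \<in> carrier G \<Longrightarrow>
      alpha G p s \<sigma> n (g, h) = cocycle_bicharacter G f (\<psi> g, \<psi> h)"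
    using bicharacter_equivalent_alpha[OF cocycle_bicharacter_alternating[OF f]] by blast
  \<comment> \<open>\<psi> expresses \<alpha>\<open>\<^sub>n\<close> through the bicharacter of
    \<open>f\<close>; an isometry starting at \<open>f\<close> asks for the opposite
    direction.\<close>
  define \<psi>' where "\<psi>' = inv_into (carrier G) \<psi>"
  have \<psi>': "\<psi>' \<in> iso G G"
    unfolding \<psi>'_def using \<psi> by (rule iso_set_sym)
  have bij: "bij_betw \<psi> (carrier G) (carrier G)"
    using \<psi> by (simp add: iso_def)
  have "cocycle_bicharacter G f (g, h) = cocycle_bicharacter G (F n) (\<psi>' g, \<psi>' h)"
    if "g \<in> carrier G" "h \<in> carrier G" for g h
  proof -
    have "\<psi>' g \<in> carrier G" "\<psi>' h \<in> carrier G"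
      using \<psi>' that by (auto simp: iso_def hom_def)
    then show ?thesis
      using eq F[OF n] bij_betw_inv_into_right[OF bij] that by (simp add: \<psi>'_def)
  qed
  then have "isometric G f G (F n)"
    using \<psi>' F[OF n] f by (subst isometric_iff_bicharacter) auto
  with n show ?thesis
    by (rule that)
qed

end

theorem theorem3p6:
  fixes G :: "('a, 'm) monoid_scheme" and \<sigma> :: "nat \<Rightarrow> 'a" and p s :: nat
  assumes "Factorial_Ring.prime p" and "s > 0" and "direct_product_cyclic G p s \<sigma>"
  shows "(\<forall>i \<le> s div 2. \<exists>!\<alpha>. \<alpha> \<in> alternating_bicharacters G \<and> alpha_values p s \<sigma> i \<alpha>) \<and>
    (\<forall>i \<le> s div 2. \<exists>f \<in> cocycles2 G. cocycle_bicharacter G f = alpha G p s \<sigma> i) \<and>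
    (\<forall>F :: nat \<Rightarrow> 'a \<times> 'a \<Rightarrow> complex.
       (\<forall>i \<le> s div 2. F i \<in> cocycles2 G \<and> cocycle_bicharacter G (F i) = alpha G p s \<sigma> i) \<longrightarrow>
       (\<forall>f \<in> cocycles2 G. \<exists>!i. i \<le> s div 2 \<and> isometric G f G (F i)))"
proof -
  obtain coord where "elementary_abelian G p s \<sigma> coord"
    using elementary_abelian_of_direct_product_cyclic[OF assms(1,3)] .
  then interpret elementary_abelian G p s \<sigma> coord .
  show ?thesis
  proof (intro conjI allI impI ballI)
    fix i assume "i \<le> s div 2"
    then have i: "2 * i \<le> s"
      by simp
    show "\<exists>!\<alpha>. \<alpha> \<in> alternating_bicharacters G \<and> alpha_values p s \<sigma> i \<alpha>"
      by (rule alpha_values_unique[OF i])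
    show "\<exists>f\<in>cocycles2 G. cocycle_bicharacter G f = alpha G p s \<sigma> i"
      using standard_cocycle_in_cocycles2[OF i] alpha_eq_standard[OF i]
      unfolding standard_bicharacter_def[OF i] by metis
  next
    fix F :: "nat \<Rightarrow> 'a \<times> 'a \<Rightarrow> complex" and f
    assume F: "\<forall>i\<le>s div 2. F i \<in> cocycles2 G \<and> cocycle_bicharacter G (F i) = alpha G p s \<sigma> i"
      and f: "f \<in> cocycles2 G"
    then obtain i where i: "i \<le> s div 2" "isometric G f G (F i)"
      using isometric_alpha_exists[of F f] by blast
    then show "\<exists>!i. i \<le> s div 2 \<and> isometric G f G (F i)"
      using isometric_alpha_unique[of F f] F f by blast
  qed
qed

end
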